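(* Let $(k,\sigma)$ be an ACFA. Suppose $f\in k_\sigma[x_1^{\pm1},\dots,x_n^{\pm1}]$ is a Laurent difference polynomial that is not a monomial. Then $f$ has a root in $(k^* )^n$.
   Context: A difference field is a field together with a field automorphism $\sigma$. An ACFA is a difference field $(k,\sigma)$ such that every finite system of difference polynomial equations over $k$ having a solution in some difference field extension of $k$ has a solution in $k$. $k_\sigma[x_1^{\pm1},\dots,x_n^{\pm1}]$ is the Laurent polynomial ring over $k$ in the formal variables $\sigma^j(x_i)$, $j\ge 0$, $1\le i\le n$ (with $\sigma^0(x_i)=x_i$); its elements are evaluated at $y\in(k^* )^n$ by substituting $\sigma^j(y_i)$ for $\sigma^j(x_i)$. A monomial is a single term $c\prod_{i,j}\sigma^j(x_i)^{a_{i,j}}$ with $c\in k^*$ and $a_{i,j}\in\mathbb{Z}$ (finitely many nonzero). *)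

theory Defs
  imports "HOL-Algebra.Algebraic_Closure_Type" "HOL-Library.Poly_Mapping"
begin

definition difference_field :: "'b ring \<Rightarrow> ('b \<Rightarrow> 'b) \<Rightarrow> bool" where
  "difference_field L \<tau> \<longleftrightarrow> field L \<and> \<tau> \<in> ring_iso L L"

text \<open>
  Extensions are given by an embedding \<open>\<iota>\<close> compatible with the automorphisms; it is injective
  because it is a unital ring homomorphism between fields.
\<close>

definition difference_field_ext ::
  "'a ring \<Rightarrow> ('a \<Rightarrow> 'a) \<Rightarrow> 'b ring \<Rightarrow> ('b \<Rightarrow> 'b) \<Rightarrow> ('a \<Rightarrow> 'b) \<Rightarrow> bool" where
  "difference_field_ext K \<sigma> L \<tau> \<iota> \<longleftrightarrow>
     difference_field K \<sigma> \<and> difference_field L \<tau> \<and>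
     \<iota> \<in> ring_hom K L \<and> (\<forall>x\<in>carrier K. \<iota> (\<sigma> x) = \<tau> (\<iota> x))"

text \<open>
  The pair \<open>(i, j)\<close> stands for the formal variable \<open>\<sigma>\<^sup>j(x\<^sub>i)\<close>. An exponent vector is a finitely
  supported map on these pairs, and a (Laurent) polynomial is a finitely supported map from
  exponent vectors to coefficients; the ring structure that Poly_Mapping puts on these types is
  the usual one of (Laurent) polynomials.
\<close>

type_synonym 'a diff_poly = "((nat \<times> nat) \<Rightarrow>\<^sub>0 nat) \<Rightarrow>\<^sub>0 'a"
type_synonym 'a laurent_diff_poly = "((nat \<times> nat) \<Rightarrow>\<^sub>0 int) \<Rightarrow>\<^sub>0 'a"

text \<open>
  Value of a polynomial \<open>p\<close> over the base field at a point \<open>z\<close> of the extension \<open>(L, \<tau>)\<close>, the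
  coefficients being mapped to \<open>L\<close> by \<open>\<iota>\<close>.
\<close>

definition diff_eval ::
  "'b ring \<Rightarrow> ('b \<Rightarrow> 'b) \<Rightarrow> ('a::zero \<Rightarrow> 'b) \<Rightarrow> 'a diff_poly \<Rightarrow> (nat \<Rightarrow> 'b) \<Rightarrow> 'b" where
  "diff_eval L \<tau> \<iota> p z =
     (\<Oplus>\<^bsub>L\<^esub>m\<in>Poly_Mapping.keys p. \<iota> (Poly_Mapping.lookup p m) \<otimes>\<^bsub>L\<^esub>
        (\<Otimes>\<^bsub>L\<^esub>v\<in>Poly_Mapping.keys m.
           ((\<tau> ^^ snd v) (z (fst v))) [^]\<^bsub>L\<^esub> Poly_Mapping.lookup m v))"

text \<open>
  A finite system involves only finitely many unknowns; a solution assigns values to all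
  \<open>x\<^sub>0, x\<^sub>1, \<dots>\<close>, those of the unknowns that do not occur being irrelevant.
\<close>

definition diff_solution ::
  "'b ring \<Rightarrow> ('b \<Rightarrow> 'b) \<Rightarrow> ('a::zero \<Rightarrow> 'b) \<Rightarrow> 'a diff_poly set \<Rightarrow> (nat \<Rightarrow> 'b) \<Rightarrow> bool" where
  "diff_solution L \<tau> \<iota> S z \<longleftrightarrow>
     (\<forall>i. z i \<in> carrier L) \<and> (\<forall>p\<in>S. diff_eval L \<tau> \<iota> p z = \<zero>\<^bsub>L\<^esub>)"

definition laurent_diff_polys :: "nat \<Rightarrow> 'a::zero laurent_diff_poly set" where
  "laurent_diff_polys n = {f. \<forall>m\<in>Poly_Mapping.keys f. \<forall>v\<in>Poly_Mapping.keys m. fst v \<in> {1..n}}"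

definition laurent_monomial :: "'a::zero laurent_diff_poly \<Rightarrow> bool" where
  "laurent_monomial f \<longleftrightarrow> (\<exists>c m. c \<noteq> 0 \<and> f = Poly_Mapping.single m c)"

definition laurent_eval ::
  "('a \<Rightarrow> 'a) \<Rightarrow> 'a::field laurent_diff_poly \<Rightarrow> (nat \<Rightarrow> 'a) \<Rightarrow> 'a" where
  "laurent_eval \<sigma> f y =
     (\<Sum>m\<in>Poly_Mapping.keys f. Poly_Mapping.lookup f m *
        (\<Prod>v\<in>Poly_Mapping.keys m. ((\<sigma> ^^ snd v) (y (fst v))) powi Poly_Mapping.lookup m v))"

text \<open>
  HOL cannot quantify over types inside a formula, so the extensions \<open>L\<close> below have their carrier
  in the type of words over \<open>'a + nat\<close>. This loses nothing: if a system is solvable in some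
  extension, it is solvable in the difference subfield generated by the base field and the
  solution, whose elements can be named by such words. Theorem \<open>acfaD\<close> proves this: for an
  \<open>acfa\<close>, systems solvable in a difference field extension carried by an arbitrary type \<open>'c\<close>
  are solvable in the base field.
\<close>

definition acfa :: "('a::field \<Rightarrow> 'a) \<Rightarrow> bool" where
  "acfa \<sigma> \<longleftrightarrow>
     difference_field ring_of_type_algebra \<sigma> \<and>
     (\<forall>S :: 'a diff_poly set. finite S \<longrightarrow>
        (\<exists>(L :: ('a + nat) list ring) \<tau> \<iota> z.
           difference_field_ext ring_of_type_algebra \<sigma> L \<tau> \<iota> \<and> diff_solution L \<tau> \<iota> S z) \<longrightarrow>
        (\<exists>y. diff_solution ring_of_type_algebra \<sigma> id S y))"

lemma diff_eval_hom:
  fixes M :: "'b ring" and N :: "'c ring" and p :: "'a::zero diff_poly"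
  assumes "cring M" "cring N" and h: "h \<in> ring_hom M N"
    and \<tau>: "\<And>x. x \<in> carrier M \<Longrightarrow> \<tau> x \<in> carrier M"
    and comm: "\<And>x. x \<in> carrier M \<Longrightarrow> h (\<tau> x) = \<tau>' (h x)"
    and \<iota>: "\<And>a. \<iota> a \<in> carrier M" and z: "\<And>i. z i \<in> carrier M"
  shows "diff_eval N \<tau>' (h \<circ> \<iota>) p (h \<circ> z) = h (diff_eval M \<tau> \<iota> p z)"
proof -
  interpret ring_hom_cring M N h
    using assms(1-3) by (intro ring_hom_cring.intro ring_hom_cring_axioms.intro)
  have it: "(\<tau> ^^ j) x \<in> carrier M" if "x \<in> carrier M" for j x
    using that by (induction j) (auto intro: \<tau>)
  have ith: "h ((\<tau> ^^ j) x) = (\<tau>' ^^ j) (h x)" if "x \<in> carrier M" for j x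
    using that by (induction j) (auto simp: comm it)
  have pw: "h (x [^]\<^bsub>M\<^esub> k) = h x [^]\<^bsub>N\<^esub> k" if "x \<in> carrier M" for x and k :: nat
    using that by (induction k) auto
  have P: "(\<Otimes>\<^bsub>M\<^esub>v\<in>Poly_Mapping.keys m. ((\<tau> ^^ snd v) (z (fst v))) [^]\<^bsub>M\<^esub> Poly_Mapping.lookup m v) \<in> carrier M"
    for m :: "(nat \<times> nat) \<Rightarrow>\<^sub>0 nat"
    by (rule R.finprod_closed) (auto intro!: R.nat_pow_closed it z)
  have itN: "(\<tau>' ^^ j) (h x) \<in> carrier N" if "x \<in> carrier M" for j x
    using that by (simp add: it flip: ith)
  have Q: "h (\<Otimes>\<^bsub>M\<^esub>v\<in>Poly_Mapping.keys m.
        ((\<tau> ^^ snd v) (z (fst v))) [^]\<^bsub>M\<^esub> Poly_Mapping.lookup m v) =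
      (\<Otimes>\<^bsub>N\<^esub>v\<in>Poly_Mapping.keys m.
        ((\<tau>' ^^ snd v) (h (z (fst v)))) [^]\<^bsub>N\<^esub> Poly_Mapping.lookup m v)"
    for m :: "(nat \<times> nat) \<Rightarrow>\<^sub>0 nat"
    by (subst hom_finprod)
       (auto intro!: R.nat_pow_closed S.nat_pow_closed S.finprod_cong' simp: pw ith it itN z)
  have QN: "(\<Otimes>\<^bsub>N\<^esub>v\<in>Poly_Mapping.keys m.
      ((\<tau>' ^^ snd v) (h (z (fst v)))) [^]\<^bsub>N\<^esub> Poly_Mapping.lookup m v) \<in> carrier N"
    for m :: "(nat \<times> nat) \<Rightarrow>\<^sub>0 nat"
    by (rule S.finprod_closed) (auto intro!: S.nat_pow_closed itN z)
  show ?thesis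
    unfolding diff_eval_def
    by (subst hom_finsum) (auto intro!: S.finsum_cong' simp: P Q QN \<iota>)
qed

context
  fixes L :: "'c ring" and \<tau> :: "'c \<Rightarrow> 'c" and \<iota> :: "'a \<Rightarrow> 'c" and z :: "nat \<Rightarrow> 'c"
begin

text \<open>
  Words over \<open>'a + nat\<close> are read as programs of a stack machine; the elements computed by some
  program form the difference subfield generated by the image of \<open>\<iota>\<close> and the values of \<open>z\<close>.
\<close>

fun word_step :: "'c list \<Rightarrow> 'a + nat \<Rightarrow> 'c list" where
  "word_step st (Inl a) = \<iota> a # st"
| "word_step st (Inr k) =
     (if k = 0 then (case st of x # y # s \<Rightarrow> (y \<oplus>\<^bsub>L\<^esub> x) # s | _ \<Rightarrow> [])
      else if k = 1 then (case st of x # y # s \<Rightarrow> (y \<otimes>\<^bsub>L\<^esub> x) # s | _ \<Rightarrow> [])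
      else if k = 2 then (case st of x # s \<Rightarrow> (\<ominus>\<^bsub>L\<^esub> x) # s | _ \<Rightarrow> [])
      else if k = 3 then (case st of x # s \<Rightarrow> (inv\<^bsub>L\<^esub> x) # s | _ \<Rightarrow> [])
      else if k = 4 then (case st of x # s \<Rightarrow> \<tau> x # s | _ \<Rightarrow> [])
      else if k = 5 then (case st of x # s \<Rightarrow> inv_into (carrier L) \<tau> x # s | _ \<Rightarrow> [])
      else z (k - 6) # st)"

definition word_val :: "('a + nat) list \<Rightarrow> 'c \<Rightarrow> bool" where
  "word_val w v \<longleftrightarrow> (\<forall>st. foldl word_step st w = v # st)"

definition word_subfield :: "'c set" where
  "word_subfield = {v \<in> carrier L. \<exists>w. word_val w v}"

definition word_name :: "'c \<Rightarrow> ('a + nat) list" where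
  "word_name v = (SOME w. word_val w v)"

lemma inj_on_word_name: "inj_on word_name word_subfield"
proof (rule inj_onI)
  have name: "word_val (word_name v) v" if "v \<in> word_subfield" for v
    using that unfolding word_subfield_def word_name_def by (metis (mono_tags, lifting) mem_Collect_eq someI_ex)
  fix u v assume "u \<in> word_subfield" "v \<in> word_subfield" "word_name u = word_name v"
  then have "word_val (word_name u) u" "word_val (word_name u) v"
    using name[of u] name[of v] by simp_all
  then show "u = v" unfolding word_val_def by (metis list.inject)
qed

lemma word_subfield_const: "\<iota> a \<in> carrier L \<Longrightarrow> \<iota> a \<in> word_subfield"
  by (auto simp: word_subfield_def word_val_def intro!: exI[of _ "[Inl a]"])

lemma word_subfield_point: "z i \<in> carrier L \<Longrightarrow> z i \<in> word_subfield"
  by (auto simp: word_subfield_def word_val_def intro!: exI[of _ "[Inr (i + 6)]"])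

lemma word_subfield_binop:
  assumes "u \<in> word_subfield" "v \<in> word_subfield"
  shows "u \<oplus>\<^bsub>L\<^esub> v \<in> carrier L \<Longrightarrow> u \<oplus>\<^bsub>L\<^esub> v \<in> word_subfield"
    and "u \<otimes>\<^bsub>L\<^esub> v \<in> carrier L \<Longrightarrow> u \<otimes>\<^bsub>L\<^esub> v \<in> word_subfield"
proof -
  obtain w1 w2 where w: "word_val w1 u" "word_val w2 v"
    using assms by (auto simp: word_subfield_def)
  then have "word_val (w1 @ w2 @ [Inr 0]) (u \<oplus>\<^bsub>L\<^esub> v)" "word_val (w1 @ w2 @ [Inr 1]) (u \<otimes>\<^bsub>L\<^esub> v)"
    by (auto simp: word_val_def)
  then show "u \<oplus>\<^bsub>L\<^esub> v \<in> carrier L \<Longrightarrow> u \<oplus>\<^bsub>L\<^esub> v \<in> word_subfield"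
    and "u \<otimes>\<^bsub>L\<^esub> v \<in> carrier L \<Longrightarrow> u \<otimes>\<^bsub>L\<^esub> v \<in> word_subfield"
    unfolding word_subfield_def by blast+
qed

lemma word_subfield_unop:
  assumes "u \<in> word_subfield"
  shows "\<ominus>\<^bsub>L\<^esub> u \<in> carrier L \<Longrightarrow> \<ominus>\<^bsub>L\<^esub> u \<in> word_subfield"
    and "inv\<^bsub>L\<^esub> u \<in> carrier L \<Longrightarrow> inv\<^bsub>L\<^esub> u \<in> word_subfield"
    and "\<tau> u \<in> carrier L \<Longrightarrow> \<tau> u \<in> word_subfield"
    and "inv_into (carrier L) \<tau> u \<in> carrier L \<Longrightarrow> inv_into (carrier L) \<tau> u \<in> word_subfield"
proof -
  obtain w where w: "word_val w u"
    using assms by (auto simp: word_subfield_def)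
  then have "word_val (w @ [Inr 2]) (\<ominus>\<^bsub>L\<^esub> u)" "word_val (w @ [Inr 3]) (inv\<^bsub>L\<^esub> u)"
    "word_val (w @ [Inr 4]) (\<tau> u)" "word_val (w @ [Inr 5]) (inv_into (carrier L) \<tau> u)"
    by (auto simp: word_val_def)
  then show "\<ominus>\<^bsub>L\<^esub> u \<in> carrier L \<Longrightarrow> \<ominus>\<^bsub>L\<^esub> u \<in> word_subfield"
    and "inv\<^bsub>L\<^esub> u \<in> carrier L \<Longrightarrow> inv\<^bsub>L\<^esub> u \<in> word_subfield"
    and "\<tau> u \<in> carrier L \<Longrightarrow> \<tau> u \<in> word_subfield"
    and "inv_into (carrier L) \<tau> u \<in> carrier L \<Longrightarrow> inv_into (carrier L) \<tau> u \<in> word_subfield"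
    unfolding word_subfield_def by blast+
qed

end

lemma diff_solution_transfer:
  fixes \<sigma> :: "'a::field \<Rightarrow> 'a" and L :: "'c ring"
  assumes ext: "difference_field_ext ring_of_type_algebra \<sigma> L \<tau> \<iota>"
    and sol: "diff_solution L \<tau> \<iota> S z"
  shows "\<exists>(L' :: ('a + nat) list ring) \<tau>' \<iota>' z'.
    difference_field_ext ring_of_type_algebra \<sigma> L' \<tau>' \<iota>' \<and> diff_solution L' \<tau>' \<iota>' S z'"
proof -
  define K where "K = (ring_of_type_algebra :: 'a ring)"
  have K: "carrier K = UNIV" by (simp add: K_def ring_of_type_algebra_def)
  have DK: "difference_field K \<sigma>" and "field L" and \<tau>: "\<tau> \<in> ring_iso L L" and \<iota>: "\<iota> \<in> ring_hom K L"
    and comm: "\<And>x. \<iota> (\<sigma> x) = \<tau> (\<iota> x)"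
    using ext by (auto simp: difference_field_ext_def difference_field_def K K_def[symmetric])
  interpret L: field L by fact
  have z: "z i \<in> carrier L" for i using sol by (auto simp: diff_solution_def)
  have \<iota>L: "\<iota> a \<in> carrier L" for a using ring_hom_closed[OF \<iota>, of a] K by auto
  have bij: "bij_betw \<tau> (carrier L) (carrier L)" and \<tau>h: "\<tau> \<in> ring_hom L L"
    using \<tau> by (auto simp: ring_iso_def)
  define M where "M = word_subfield L \<tau> \<iota> z"
  have Msub: "M \<subseteq> carrier L" by (auto simp: M_def word_subfield_def)
  have \<iota>M: "\<iota> a \<in> M" for a unfolding M_def by (rule word_subfield_const) (rule \<iota>L)
  have zM: "z i \<in> M" for i unfolding M_def by (rule word_subfield_point) (rule z)
  have \<tau>L: "\<tau> x \<in> carrier L" if "x \<in> carrier L" for x using ring_hom_closed[OF \<tau>h that] .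
  have \<tau>M: "\<tau> x \<in> M" if "x \<in> M" for x
    using that word_subfield_unop(3)[of x L \<tau> \<iota> z] \<tau>L Msub unfolding M_def by blast
  have \<tau>M': "x \<in> \<tau> ` M" if "x \<in> M" for x
  proof -
    have xL: "x \<in> \<tau> ` carrier L" using that Msub bij by (auto simp: bij_betw_def)
    have "inv_into (carrier L) \<tau> x \<in> M"
      using that word_subfield_unop(4)[of x L \<tau> \<iota> z] inv_into_into[OF xL] unfolding M_def by blast
    with f_inv_into_f[OF xL] show ?thesis by (metis imageI)
  qed
  have one: "\<one>\<^bsub>L\<^esub> \<in> M" using \<iota>M[of "\<one>\<^bsub>K\<^esub>"] ring_hom_one[OF \<iota>] by simp
  have "subring M L"
  proof (rule L.subringI)
    show "M \<subseteq> carrier L" by fact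
    show "\<one>\<^bsub>L\<^esub> \<in> M" by fact
    show "\<ominus>\<^bsub>L\<^esub> h \<in> M" if "h \<in> M" for h
      using that word_subfield_unop(1)[of h L \<tau> \<iota> z] Msub unfolding M_def by blast
    show "h1 \<otimes>\<^bsub>L\<^esub> h2 \<in> M" if "h1 \<in> M" "h2 \<in> M" for h1 h2
      using that word_subfield_binop(2)[of h1 L \<tau> \<iota> z h2] Msub unfolding M_def by blast
    show "h1 \<oplus>\<^bsub>L\<^esub> h2 \<in> M" if "h1 \<in> M" "h2 \<in> M" for h1 h2
      using that word_subfield_binop(1)[of h1 L \<tau> \<iota> z h2] Msub unfolding M_def by blast
  qed
  then have sub: "subfield M L"
  proof (rule L.subfieldI')
    show "inv\<^bsub>L\<^esub> k \<in> M" if "k \<in> M - {\<zero>\<^bsub>L\<^esub>}" for k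
    proof -
      have "inv\<^bsub>L\<^esub> k \<in> carrier L" using that Msub by (auto simp: L.field_Units intro!: L.Units_inv_closed)
      then show ?thesis using that word_subfield_unop(2)[of k L \<tau> \<iota> z] unfolding M_def by blast
    qed
  qed
  define LM where "LM = L\<lparr>carrier := M\<rparr>"
  have "field LM" using L.subfield_iff(2)[OF sub] by (simp add: LM_def)
  interpret LM: field LM by fact
  define g where "g = word_name L \<tau> \<iota> z"
  have inj: "inj_on g M" unfolding g_def M_def by (rule inj_on_word_name)
  have cM: "carrier LM = M" by (simp add: LM_def)
  define N where "N = image_ring g LM"
  have "field N" unfolding N_def
    by (rule LM.inj_imp_image_ring_is_field) (simp add: cM inj)
  interpret N: field N by fact
  have giso: "g \<in> ring_iso LM N" unfolding N_def
    by (rule inj_imp_image_ring_iso) (simp add: cM inj)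
  then have gh: "g \<in> ring_hom LM N" by (simp add: ring_iso_def)
  have \<tau>LM: "\<tau> \<in> ring_iso LM LM"
  proof (rule ring_iso_memI)
    show "bij_betw \<tau> (carrier LM) (carrier LM)"
      using bij Msub \<tau>M \<tau>M' unfolding cM bij_betw_def by (auto intro: inj_on_subset)
  qed (use \<tau>h Msub \<tau>M in \<open>auto simp: LM_def ring_hom_def subset_iff\<close>)
  define g' where "g' = inv_into M g"
  have g'iso: "g' \<in> ring_iso N LM"
    using ring_iso_set_sym[OF _ giso] LM.ring_axioms by (simp add: g'_def cM)
  define \<tau>' where "\<tau>' = g \<circ> \<tau> \<circ> g'"
  have \<tau>'iso: "\<tau>' \<in> ring_iso N N"
    unfolding \<tau>'_def using g'iso \<tau>LM giso by (metis ring_iso_set_trans)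
  have commg: "g (\<tau> x) = \<tau>' (g x)" if "x \<in> M" for x
    using that inj by (simp add: \<tau>'_def g'_def)
  have \<iota>LM: "\<iota> \<in> ring_hom K LM"
    using \<iota> \<iota>M by (auto simp: ring_hom_def LM_def)
  have "difference_field_ext K \<sigma> N \<tau>' (g \<circ> \<iota>)"
    unfolding difference_field_ext_def difference_field_def[of N]
    using DK \<open>field N\<close> \<tau>'iso ring_hom_trans[OF \<iota>LM gh] by (auto simp: comm commg \<iota>M)
  moreover have "diff_solution N \<tau>' (g \<circ> \<iota>) S (g \<circ> z)"
    unfolding diff_solution_def
  proof (intro conjI allI ballI)
    show "(g \<circ> z) i \<in> carrier N" for i
      using ring_hom_closed[OF gh] zM by (simp add: cM)
    fix p assume "p \<in> S"
    have idh: "id \<in> ring_hom LM L" using Msub by (auto simp: ring_hom_def LM_def)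
    have "diff_eval L \<tau> (id \<circ> \<iota>) p (id \<circ> z) = id (diff_eval LM \<tau> \<iota> p z)"
      by (rule diff_eval_hom[OF LM.is_cring L.is_cring idh]) (auto simp: cM \<tau>M \<iota>M zM)
    then have "diff_eval LM \<tau> \<iota> p z = \<zero>\<^bsub>LM\<^esub>"
      using sol \<open>p \<in> S\<close> by (simp add: diff_solution_def LM_def)
    moreover have "diff_eval N \<tau>' (g \<circ> \<iota>) p (g \<circ> z) = g (diff_eval LM \<tau> \<iota> p z)"
      by (rule diff_eval_hom[OF LM.is_cring N.is_cring gh]) (auto simp: cM \<tau>M \<iota>M zM commg)
    ultimately show "diff_eval N \<tau>' (g \<circ> \<iota>) p (g \<circ> z) = \<zero>\<^bsub>N\<^esub>"
      using ring_hom_zero[OF gh LM.ring_axioms N.ring_axioms] by simp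
  qed
  ultimately show ?thesis unfolding K_def by blast
qed

theorem acfaD:
  fixes \<sigma> :: "'a::field \<Rightarrow> 'a" and L :: "'c ring"
  assumes "acfa \<sigma>" "finite S"
    and "difference_field_ext ring_of_type_algebra \<sigma> L \<tau> \<iota>" "diff_solution L \<tau> \<iota> S z"
  shows "\<exists>y. diff_solution ring_of_type_algebra \<sigma> id S y"
  using assms(1,2) diff_solution_transfer[OF assms(3,4)] unfolding acfa_def by blast

lemma diff_eval_type:
  fixes \<tau> :: "'b::field \<Rightarrow> 'b"
  shows "diff_eval ring_of_type_algebra \<tau> \<iota> p z =
    (\<Sum>m\<in>Poly_Mapping.keys p. \<iota> (Poly_Mapping.lookup p m) *
       (\<Prod>v\<in>Poly_Mapping.keys m. ((\<tau> ^^ snd v) (z (fst v))) ^ Poly_Mapping.lookup m v))"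
proof -
  define K where "K = (ring_of_type_algebra :: 'b ring)"
  interpret K: field K unfolding K_def by (rule field_from_type_algebra)
  have [simp]: "carrier K = UNIV" "\<zero>\<^bsub>K\<^esub> = 0" "\<one>\<^bsub>K\<^esub> = 1" "x \<oplus>\<^bsub>K\<^esub> y = x + y" "x \<otimes>\<^bsub>K\<^esub> y = x * y" for x y
    by (simp_all add: K_def ring_of_type_algebra_def)
  have pw: "x [^]\<^bsub>K\<^esub> k = x ^ k" for x and k :: nat
    by (induction k) (simp_all add: mult.commute)
  have fs: "finsum K f A = sum f A" if "finite A" for f :: "'i \<Rightarrow> 'b" and A
    using that by (induction A rule: finite_induct) auto
  have fp: "finprod K f A = prod f A" if "finite A" for f :: "'i \<Rightarrow> 'b" and A
    using that by (induction A rule: finite_induct) auto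
  show ?thesis unfolding diff_eval_def K_def[symmetric] by (simp add: fs fp pw)
qed

end

(*
  It suffices to solve the equation in some difference field extension of k by nonzero elements.
  Substituting iterated conjugates of a single unknown t for the x_i makes it an equation
  G(t, tau t, ..., tau^d t) = 0 in which X_d occurs with two different exponents.

  Let L be the algebraic closure of k(X_0, X_1, ...) and b a nonzero root in L of
  G(X_0, ..., X_{d-1}, Z).  The naive extension of sigma, X_j -> X_{j+1} for j < d - 1 and
  X_{d-1} -> b, need not be injective: b may be algebraic over k(X_1, ..., X_{d-1}).  So let
  p <= d be maximal such that G(y_0, ..., y_{p-1}, X_p, ..., X_{d-1}, b) = 0 for all y in L^p.
  If p = d, any lift tau of sigma to L works, with t = tau^{-d} b.  If p < d, then
  specialising X_0, ..., X_p to suitable X_j with j > d gives a nontrivial algebraic relation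
  for X_p over the other variables and b.  Hence b and the X_j, j <> p, form another
  transcendence basis of L over k, and the cycle X_p -> ... -> X_{d-1} -> b (all other X_j
  fixed) extends to an automorphism tau of L; again t = tau^{-d} b is a solution, since
  tau^j t = X_j for p <= j < d.
*)
theory Submission
  imports Defs "HOL-Computational_Algebra.Fraction_Field"
begin


section \<open>Evaluating polynomials in several variables\<close>

text \<open>Three requirements shape the construction of \<tau>. It must be onto: hence it comes
  from matching two transcendence bases over each of which L is algebraic, not merely from an
  embedding. In the cycle, X_p is the one variable that is not the image of a variable, and it is
  exactly the one that b replaces in the second basis. The element t must satisfy G at its own
  conjugates: \<tau>^j t is known only for p \<le> j \<le> d, and the uncontrolled conjugates with j
  < p are harmless because, by the choice of p, these arguments have no influence. Maximality of p
  says that argument p does have influence; this survives when the arguments 0, ..., p move to fresh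
  variables, of which the infinite supply provides enough, while X_{p+1}, ..., X_{d-1} and b stay in
  place. Finally, all coordinates must be nonzero: two different exponents of X_d give the
  polynomial that defines b two terms, hence a root other than 0, and t is carried to b by an
  injective map that fixes 0.\<close>

locale ring_map =
  fixes h :: "'a::comm_ring_1 \<Rightarrow> 'b::comm_ring_1"
  assumes one [simp]: "h 1 = 1"
    and add: "h (x + y) = h x + h y"
    and mult: "h (x * y) = h x * h y"
begin

lemma zero [simp]: "h 0 = 0"
  using add[of 0 0] by simp

lemma uminus: "h (- x) = - h x"
  using add[of x "- x"] by (simp add: eq_neg_iff_add_eq_0 add.commute)

lemma diff: "h (x - y) = h x - h y"
  using add[of x "- y"] by (simp add: uminus)

lemma sum: "h (\<Sum>i\<in>I. g i) = (\<Sum>i\<in>I. h (g i))"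
  by (induction I rule: infinite_finite_induct) (auto simp: add)

lemma prod: "h (\<Prod>i\<in>I. g i) = (\<Prod>i\<in>I. h (g i))"
  by (induction I rule: infinite_finite_induct) (auto simp: mult)

lemma power: "h (x ^ n) = h x ^ n"
  by (induction n) (auto simp: mult)

lemma inj_onI_kernel: "(\<And>x. h x = 0 \<Longrightarrow> x = 0) \<Longrightarrow> inj h"
  by (metis diff eq_iff_diff_eq_0 injI)

end

lemma ring_map_comp: "ring_map g \<Longrightarrow> ring_map h \<Longrightarrow> ring_map (g \<circ> h)"
  by (simp add: ring_map_def)

lemma ring_map_id: "ring_map (\<lambda>x. x)"
  by (simp add: ring_map_def)

lemma ring_map_const: "ring_map (\<lambda>c. Poly_Mapping.single (0 :: 'v \<Rightarrow>\<^sub>0 nat) (c :: 'a::comm_ring_1))"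
  by unfold_locales (simp_all add: single_add mult_single)

definition mp_monom :: "('v \<Rightarrow> 'b::comm_ring_1) \<Rightarrow> ('v \<Rightarrow>\<^sub>0 nat) \<Rightarrow> 'b" where
  "mp_monom w m = (\<Prod>v\<in>Poly_Mapping.keys m. w v ^ Poly_Mapping.lookup m v)"

definition mp_eval ::
  "('a::zero \<Rightarrow> 'b::comm_ring_1) \<Rightarrow> ('v \<Rightarrow> 'b) \<Rightarrow> (('v \<Rightarrow>\<^sub>0 nat) \<Rightarrow>\<^sub>0 'a) \<Rightarrow> 'b" where
  "mp_eval \<phi> w r = (\<Sum>m\<in>Poly_Mapping.keys r. \<phi> (Poly_Mapping.lookup r m) * mp_monom w m)"

lemma mp_monom_superset:
  assumes "finite V" "Poly_Mapping.keys m \<subseteq> V"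
  shows "mp_monom w m = (\<Prod>v\<in>V. w v ^ Poly_Mapping.lookup m v)"
  unfolding mp_monom_def
  by (rule prod.mono_neutral_left) (use assms in \<open>auto simp: in_keys_iff\<close>)

lemma mp_monom_zero [simp]: "mp_monom w 0 = 1"
  by (simp add: mp_monom_def)

lemma mp_monom_add: "mp_monom w (m + n) = mp_monom w m * mp_monom w n"
proof -
  define V where "V = Poly_Mapping.keys m \<union> Poly_Mapping.keys n"
  have "finite V" "Poly_Mapping.keys m \<subseteq> V" "Poly_Mapping.keys n \<subseteq> V" "Poly_Mapping.keys (m + n) \<subseteq> V"
    by (auto simp: V_def in_keys_iff lookup_add)
  then show ?thesis
    by (simp add: mp_monom_superset[of V] lookup_add power_add prod.distrib)
qed

lemma mp_monom_single [simp]: "mp_monom w (Poly_Mapping.single v n) = w v ^ n"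
  by (cases "n = 0") (simp_all add: mp_monom_def)

lemma mp_monom_cong:
  "(\<And>v. v \<in> Poly_Mapping.keys m \<Longrightarrow> w v = w' v) \<Longrightarrow> mp_monom w m = mp_monom w' m"
  by (simp add: mp_monom_def)

lemma mp_eval_cong:
  "(\<And>m v. m \<in> Poly_Mapping.keys r \<Longrightarrow> v \<in> Poly_Mapping.keys m \<Longrightarrow> w v = w' v) \<Longrightarrow>
    mp_eval \<phi> w r = mp_eval \<phi> w' r"
  unfolding mp_eval_def by (intro sum.cong refl arg_cong2[of _ _ _ _ "(*)"] mp_monom_cong) auto

lemma mp_eval_superset:
  assumes "\<phi> 0 = 0" "finite M" "Poly_Mapping.keys r \<subseteq> M"
  shows "mp_eval \<phi> w r = (\<Sum>m\<in>M. \<phi> (Poly_Mapping.lookup r m) * mp_monom w m)"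
  unfolding mp_eval_def
  by (rule sum.mono_neutral_left) (use assms in \<open>auto simp: in_keys_iff\<close>)

lemma mp_eval_single: "\<phi> 0 = 0 \<Longrightarrow> mp_eval \<phi> w (Poly_Mapping.single m c) = \<phi> c * mp_monom w m"
  by (cases "c = 0") (simp_all add: mp_eval_def)

lemma poly_mapping_sum_single:
  "r = (\<Sum>m\<in>Poly_Mapping.keys r. Poly_Mapping.single m (Poly_Mapping.lookup r m))"
  for r :: "'v \<Rightarrow>\<^sub>0 'a::comm_monoid_add"
  by (rule poly_mapping_eqI)
     (simp add: lookup_sum lookup_single when_def in_keys_iff)

text \<open>Both arguments are expanded into single terms, so that multiplicativity reduces to
  \<open>mp_monom_add\<close>.\<close>

lemma (in ring_map) mp_eval_ring_map: "ring_map (mp_eval h w)"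
proof -
  have a: "mp_eval h w (r + s) = mp_eval h w r + mp_eval h w s" for r s
  proof -
    define M where "M = Poly_Mapping.keys r \<union> Poly_Mapping.keys s"
    have "finite M" "Poly_Mapping.keys r \<subseteq> M" "Poly_Mapping.keys s \<subseteq> M" "Poly_Mapping.keys (r + s) \<subseteq> M"
      using keys_add[of r s] by (auto simp: M_def)
    then show ?thesis
      by (simp add: mp_eval_superset[of h M] lookup_add add ring_distribs sum.distrib)
  qed
  have z: "mp_eval h w 0 = 0" by (simp add: mp_eval_def)
  have s: "mp_eval h w (\<Sum>i\<in>I. g i) = (\<Sum>i\<in>I. mp_eval h w (g i))" for I :: "'i set" and g
    by (induction I rule: infinite_finite_induct) (auto simp: a z)
  have m: "mp_eval h w (r * s) = mp_eval h w r * mp_eval h w s" for r s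
  proof -
    have "mp_eval h w (r * s) = mp_eval h w
      (\<Sum>m\<in>Poly_Mapping.keys r. \<Sum>n\<in>Poly_Mapping.keys s.
        Poly_Mapping.single (m + n) (Poly_Mapping.lookup r m * Poly_Mapping.lookup s n))"
      by (subst poly_mapping_sum_single[of r], subst poly_mapping_sum_single[of s])
        (simp add: sum_product mult_single)
    also have "\<dots> = mp_eval h w r * mp_eval h w s"
      unfolding mp_eval_def[of h w r] mp_eval_def[of h w s]
      by (auto simp: s mp_eval_single mp_monom_add mult sum_product mult_ac intro!: sum.cong)
    finally show ?thesis .
  qed
  show ?thesis
    by unfold_locales (simp_all add: a m mp_eval_single[where m = 0, simplified] flip: single_one)
qed

lemma (in ring_map) mp_eval_comp: "h (mp_eval \<phi> w r) = mp_eval (h \<circ> \<phi>) (h \<circ> w) r"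
  by (simp add: mp_eval_def mp_monom_def sum mult prod power)

definition mp_var :: "'v \<Rightarrow> ('v \<Rightarrow>\<^sub>0 nat) \<Rightarrow>\<^sub>0 'a::comm_ring_1" where
  "mp_var v = Poly_Mapping.single (Poly_Mapping.single v 1) 1"

abbreviation mp_const :: "'a::comm_ring_1 \<Rightarrow> ('v \<Rightarrow>\<^sub>0 nat) \<Rightarrow>\<^sub>0 'a" where
  "mp_const c \<equiv> Poly_Mapping.single 0 c"

lemma mp_var_power: "mp_var v ^ n = Poly_Mapping.single (Poly_Mapping.single v n) 1"
  by (induction n) (simp_all add: mp_var_def mult_single flip: single_add)

lemma mp_monom_mp_var: "mp_monom mp_var m = (Poly_Mapping.single m 1 :: ('v \<Rightarrow>\<^sub>0 nat) \<Rightarrow>\<^sub>0 'a::comm_ring_1)"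
proof -
  have s: "(\<Prod>v\<in>V. Poly_Mapping.single (g v) 1 :: ('v \<Rightarrow>\<^sub>0 nat) \<Rightarrow>\<^sub>0 'a) = Poly_Mapping.single (\<Sum>v\<in>V. g v) 1" if "finite V" for V :: "'v set" and g
    using that by (induction V) (auto simp: mult_single)
  show ?thesis
    by (simp add: mp_monom_def mp_var_power s poly_mapping_sum_single[of m, symmetric])
qed

lemma mp_eval_ident: "mp_eval mp_const mp_var r = r"
proof -
  have "mp_eval mp_const mp_var r = (\<Sum>m\<in>Poly_Mapping.keys r. Poly_Mapping.single m (Poly_Mapping.lookup r m))"
    by (simp add: mp_eval_def mp_monom_mp_var mult_single)
  then show ?thesis by (simp flip: poly_mapping_sum_single)
qed

lemma (in ring_map) mp_eval_var [simp]: "mp_eval h w (mp_var v) = w v"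
  by (simp add: mp_eval_single mp_var_def)

lemma (in ring_map) mp_eval_const [simp]: "mp_eval h w (mp_const c) = h c"
  by (simp add: mp_eval_single)

text \<open>Universal property of the polynomial ring: \<open>h\<close> is applied to the expansion
  of \<open>r\<close> in its own variables (\<open>mp_eval_ident\<close>).\<close>

lemma ring_map_eq_mp_eval:
  assumes "ring_map h"
  shows "h r = mp_eval (\<lambda>c. h (mp_const c)) (\<lambda>v. h (mp_var v)) r"
  using ring_map.mp_eval_comp[OF assms, of mp_const mp_var r]
  by (simp add: mp_eval_ident o_def)

text \<open>The coefficient of the \<open>i\<close>-th power of variable \<open>p\<close> when
  \<open>r\<close> is read as a univariate polynomial in that variable. It stays in the same
  polynomial ring but no longer involves \<open>p\<close>.\<close>

definition mp_coeff :: "'v \<Rightarrow> (('v \<Rightarrow>\<^sub>0 nat) \<Rightarrow>\<^sub>0 'a::comm_ring_1) \<Rightarrow> nat \<Rightarrow> ('v \<Rightarrow>\<^sub>0 nat) \<Rightarrow>\<^sub>0 'a" where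
  "mp_coeff p r i = (\<Sum>m | m \<in> Poly_Mapping.keys r \<and> Poly_Mapping.lookup m p = i.
     Poly_Mapping.single (m - Poly_Mapping.single p i) (Poly_Mapping.lookup r m))"

text \<open>Subtraction of exponents is truncated, but removing the full exponent of
  \<open>p\<close> is exact.\<close>

lemma minus_single_add: "m - Poly_Mapping.single p (Poly_Mapping.lookup m p) + Poly_Mapping.single p (Poly_Mapping.lookup m p) = m"
  for m :: "'v \<Rightarrow>\<^sub>0 nat"
  by (rule poly_mapping_eqI) (auto simp: lookup_add lookup_minus lookup_single when_def)

lemma lookup_mp_coeff:
  "Poly_Mapping.lookup (mp_coeff p r i) m =
     (if Poly_Mapping.lookup m p = 0 then Poly_Mapping.lookup r (m + Poly_Mapping.single p i) else 0)"
proof -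
  have e: "n - Poly_Mapping.single p i = m \<longleftrightarrow> Poly_Mapping.lookup m p = 0 \<and> n = m + Poly_Mapping.single p i"
    if "Poly_Mapping.lookup n p = i" for n
  proof
    show "Poly_Mapping.lookup m p = 0 \<and> n = m + Poly_Mapping.single p i" if "n - Poly_Mapping.single p i = m"
      using that \<open>Poly_Mapping.lookup n p = i\<close> minus_single_add[of n p] by (auto simp: lookup_minus)
  qed (auto intro!: poly_mapping_eqI simp: lookup_minus lookup_add)
  have "Poly_Mapping.lookup (mp_coeff p r i) m = (\<Sum>n | n \<in> Poly_Mapping.keys r \<and> Poly_Mapping.lookup n p = i.
     if Poly_Mapping.lookup m p = 0 \<and> n = m + Poly_Mapping.single p i then Poly_Mapping.lookup r n else 0)"
    unfolding mp_coeff_def lookup_sum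
    by (intro sum.cong) (auto simp: lookup_single when_def e)
  also have "\<dots> = (\<Sum>n | n \<in> Poly_Mapping.keys r \<and> Poly_Mapping.lookup n p = i \<and> n = m + Poly_Mapping.single p i.
     if Poly_Mapping.lookup m p = 0 then Poly_Mapping.lookup r n else 0)"
    by (rule sum.mono_neutral_cong_right) auto
  also have "\<dots> = (if Poly_Mapping.lookup m p = 0 then Poly_Mapping.lookup r (m + Poly_Mapping.single p i) else 0)"
  proof (cases "m + Poly_Mapping.single p i \<in> Poly_Mapping.keys r \<and> Poly_Mapping.lookup m p = 0")
    case True
    then have "{n. n \<in> Poly_Mapping.keys r \<and> Poly_Mapping.lookup n p = i \<and> n = m + Poly_Mapping.single p i} = {m + Poly_Mapping.single p i}"
      by (auto simp: lookup_add)
    then show ?thesis by simp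
  next
    case False
    then show ?thesis by (auto simp: in_keys_iff intro!: sum.neutral)
  qed
  finally show ?thesis .
qed

lemma mp_coeff_free: "m \<in> Poly_Mapping.keys (mp_coeff p r i) \<Longrightarrow> Poly_Mapping.lookup m p = 0"
  by (auto simp: in_keys_iff lookup_mp_coeff split: if_splits)

lemma keys_mp_coeff_subset:
  assumes "m \<in> Poly_Mapping.keys (mp_coeff p r i)" "v \<in> Poly_Mapping.keys m"
  shows "v \<noteq> p \<and> (\<exists>m'\<in>Poly_Mapping.keys r. v \<in> Poly_Mapping.keys m')"
proof
  show "v \<noteq> p" using mp_coeff_free[OF assms(1)] assms(2) by (auto simp: in_keys_iff)
  show "\<exists>m'\<in>Poly_Mapping.keys r. v \<in> Poly_Mapping.keys m'"
    using assms by (intro bexI[of _ "m + Poly_Mapping.single p i"])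
      (auto simp: in_keys_iff lookup_mp_coeff lookup_add split: if_splits)
qed

lemma finite_mp_coeff: "finite {i. mp_coeff p r i \<noteq> 0}"
proof (rule finite_subset)
  show "{i. mp_coeff p r i \<noteq> 0} \<subseteq> (\<lambda>m. Poly_Mapping.lookup m p) ` Poly_Mapping.keys r"
    by (force simp: mp_coeff_def intro: sum.neutral)
qed simp

lemma mp_coeff_neq_0:
  assumes "m \<in> Poly_Mapping.keys r"
  shows "mp_coeff p r (Poly_Mapping.lookup m p) \<noteq> 0"
proof -
  let ?n = "m - Poly_Mapping.single p (Poly_Mapping.lookup m p)"
  have "Poly_Mapping.lookup (mp_coeff p r (Poly_Mapping.lookup m p)) ?n = Poly_Mapping.lookup r m"
    by (simp add: lookup_mp_coeff minus_single_add lookup_minus)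
  then show ?thesis using assms by (auto simp: in_keys_iff)
qed

text \<open>The restriction of \<open>r\<close> to the line through \<open>w\<close> in direction
  \<open>p\<close>; the value \<open>w p\<close> has no effect, since \<open>mp_coeff\<close> is
  free of \<open>p\<close>.\<close>

definition mp_section ::
  "('a::comm_ring_1 \<Rightarrow> 'b::comm_ring_1) \<Rightarrow> ('v \<Rightarrow> 'b) \<Rightarrow> 'v \<Rightarrow> (('v \<Rightarrow>\<^sub>0 nat) \<Rightarrow>\<^sub>0 'a) \<Rightarrow> 'b poly" where
  "mp_section \<phi> w p r = Abs_poly (\<lambda>i. mp_eval \<phi> w (mp_coeff p r i))"

context ring_map
begin

lemma coeff_mp_section: "coeff (mp_section h w p r) i = mp_eval h w (mp_coeff p r i)"
proof -
  have "finite {i. mp_eval h w (mp_coeff p r i) \<noteq> 0}"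
    by (rule finite_subset[OF _ finite_mp_coeff[of p r]]) (auto simp: mp_eval_def)
  then show ?thesis unfolding mp_section_def
    by (subst Abs_poly_inverse) (auto simp: MOST_iff_cofinite)
qed

lemma mp_eval_coeff_decomposition:
  assumes "finite I" "(\<lambda>m. Poly_Mapping.lookup m p) ` Poly_Mapping.keys r \<subseteq> I"
  shows "mp_eval h (w(p := x)) r = (\<Sum>i\<in>I. mp_eval h w (mp_coeff p r i) * x ^ i)"
proof -
  interpret E: ring_map "mp_eval h w" by (rule mp_eval_ring_map)
  interpret E': ring_map "mp_eval h (w(p := x))" by (rule mp_eval_ring_map)
  have one: "mp_monom (w(p := x)) m = mp_monom w (m - Poly_Mapping.single p i) * x ^ i"
    if "Poly_Mapping.lookup m p = i" for m i
  proof -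
    have "mp_monom (w(p := x)) m = mp_monom (w(p := x)) (m - Poly_Mapping.single p i) * x ^ i"
      using that minus_single_add[of m p] by (metis mp_monom_add mp_monom_single fun_upd_same)
    also have "mp_monom (w(p := x)) (m - Poly_Mapping.single p i) = mp_monom w (m - Poly_Mapping.single p i)"
      using that by (intro mp_monom_cong) (auto simp: in_keys_iff lookup_minus)
    finally show ?thesis .
  qed
  have "(\<Sum>i\<in>I. mp_eval h w (mp_coeff p r i) * x ^ i) =
    (\<Sum>i\<in>I. \<Sum>m | m \<in> Poly_Mapping.keys r \<and> Poly_Mapping.lookup m p = i.
       h (Poly_Mapping.lookup r m) * mp_monom (w(p := x)) m)"
    unfolding mp_coeff_def E.sum
    by (intro sum.cong refl) (simp add: sum_distrib_right mp_eval_single one mult.assoc)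
  also have "\<dots> = mp_eval h (w(p := x)) r"
    unfolding mp_eval_def using sum.group[of "Poly_Mapping.keys r" I "\<lambda>m. Poly_Mapping.lookup m p"] assms by simp
  finally show ?thesis ..
qed

lemma poly_mp_section: "poly (mp_section h w p r) x = mp_eval h (w(p := x)) r"
proof -
  let ?s = "mp_section h w p r"
  \<comment> \<open>High coefficients may vanish after evaluation at \<open>w\<close>, so the degree
    of \<open>?s\<close> need not bound the exponents in \<open>r\<close>; the union serves both
    sums.\<close>
  define I where "I = {..degree ?s} \<union> (\<lambda>m. Poly_Mapping.lookup m p) ` Poly_Mapping.keys r"
  have "poly ?s x = (\<Sum>i\<in>I. coeff ?s i * x ^ i)"
    unfolding poly_altdef by (rule sum.mono_neutral_left) (auto simp: I_def coeff_eq_0)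
  also have "\<dots> = mp_eval h (w(p := x)) r"
    by (subst mp_eval_coeff_decomposition[of I]) (auto simp: I_def coeff_mp_section)
  finally show ?thesis .
qed

end


section \<open>Algebraic elements over a subring\<close>

definition subring_set :: "'a::comm_ring_1 set \<Rightarrow> bool" where
  "subring_set A \<longleftrightarrow> 1 \<in> A \<and> (\<forall>x\<in>A. \<forall>y\<in>A. x - y \<in> A \<and> x * y \<in> A)"

definition alg_over :: "'a::comm_ring_1 set \<Rightarrow> 'a \<Rightarrow> bool" where
  "alg_over A x \<longleftrightarrow> (\<exists>p. p \<noteq> 0 \<and> (\<forall>i. coeff p i \<in> A) \<and> poly p x = 0)"

context
  fixes A :: "'a::comm_ring_1 set"
  assumes A: "subring_set A"
begin

lemma subring_set_1: "1 \<in> A" and subring_set_diff: "x \<in> A \<Longrightarrow> y \<in> A \<Longrightarrow> x - y \<in> A"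
  and subring_set_mult: "x \<in> A \<Longrightarrow> y \<in> A \<Longrightarrow> x * y \<in> A"
  using A by (auto simp: subring_set_def)

lemma subring_set_0: "0 \<in> A"
  using subring_set_diff[OF subring_set_1 subring_set_1] by simp

lemma subring_set_uminus: "x \<in> A \<Longrightarrow> - x \<in> A"
  using subring_set_diff[OF subring_set_0, of x] by simp

lemma subring_set_add: "x \<in> A \<Longrightarrow> y \<in> A \<Longrightarrow> x + y \<in> A"
  using subring_set_diff[of x "- y"] subring_set_uminus[of y] by simp

lemma subring_set_sum: "(\<And>i. i \<in> I \<Longrightarrow> g i \<in> A) \<Longrightarrow> (\<Sum>i\<in>I. g i) \<in> A"
  by (induction I rule: infinite_finite_induct) (auto intro: subring_set_0 subring_set_add)

lemma subring_set_prod: "(\<And>i. i \<in> I \<Longrightarrow> g i \<in> A) \<Longrightarrow> (\<Prod>i\<in>I. g i) \<in> A"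
  by (induction I rule: infinite_finite_induct) (auto intro: subring_set_1 subring_set_mult)

lemma subring_set_power: "x \<in> A \<Longrightarrow> x ^ n \<in> A"
  by (induction n) (auto intro: subring_set_1 subring_set_mult)

lemma mp_eval_in_subring_set:
  assumes "\<And>c. \<phi> c \<in> A" "\<And>m v. m \<in> Poly_Mapping.keys r \<Longrightarrow> v \<in> Poly_Mapping.keys m \<Longrightarrow> w v \<in> A"
  shows "mp_eval \<phi> w r \<in> A"
  unfolding mp_eval_def mp_monom_def
  by (intro subring_set_sum subring_set_mult subring_set_prod subring_set_power assms)

end

lemma (in ring_map) subring_set_image: "subring_set A \<Longrightarrow> subring_set (h ` A)"
  unfolding subring_set_def by (auto simp flip: one diff mult)

lemma subring_set_UNIV: "subring_set UNIV"
  by (simp add: subring_set_def)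

lemma alg_over_mono: "alg_over A x \<Longrightarrow> A \<subseteq> B \<Longrightarrow> alg_over B x"
  unfolding alg_over_def by blast

lemma alg_over_self:
  assumes "subring_set A" "x \<in> A"
  shows "alg_over A x"
  unfolding alg_over_def
proof (intro exI[of _ "[:- x, 1:]"] conjI allI)
  show "coeff [:- x, 1:] i \<in> A" for i
    using subring_set_uminus[OF assms] subring_set_1[OF assms(1)] subring_set_0[OF assms(1)]
    by (auto simp: coeff_pCons split: nat.splits)
qed auto

lemma set_coeffsE:
  assumes "c \<in> set (coeffs p)"
  obtains i where "c = coeff p i"
  using assms range_coeff[of p] by (metis image_iff insertCI)

section \<open>Algebraic extensions: from ring records to field types\<close>

context
  fixes K :: "'a::field ring"
  defines "K \<equiv> ring_of_type_algebra"
begin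

interpretation K: field K
  unfolding K_def by (rule field_from_type_algebra)

lemma type_algebra_simps [simp]: "carrier K = UNIV" "\<zero>\<^bsub>K\<^esub> = 0" "\<one>\<^bsub>K\<^esub> = 1" "x \<oplus>\<^bsub>K\<^esub> y = x + y" "x \<otimes>\<^bsub>K\<^esub> y = x * y"
  by (simp_all add: K_def ring_of_type_algebra_def)

lemma type_algebra_uminus [simp]: "\<ominus>\<^bsub>K\<^esub> x = - x"
  using K.minus_equality[of "- x" x] by simp

lemma type_algebra_inverse [simp]: "x \<noteq> 0 \<Longrightarrow> inv\<^bsub>K\<^esub> x = inverse x"
  using K.comm_inv_char[of x "inverse x"] by simp

lemma type_algebra_power [simp]: "x [^]\<^bsub>K\<^esub> (n::nat) = x ^ n"
  by (induction n) (simp_all add: mult.commute)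

text \<open>Polynomials over ring records are lists with the leading coefficient first, hence the
  reversal.\<close>

lemma type_algebra_eval: "K.eval l x = poly (Poly (rev l)) x"
  by (induction l) (simp_all add: Poly_append poly_monom algebra_simps)

lemma type_algebra_algebraic:
  assumes F: "subfield F K"
  shows "(K.algebraic over F) x \<longleftrightarrow> alg_over F x"
proof
  assume "(K.algebraic over F) x"
  then obtain l where l: "l \<in> carrier (F [X]\<^bsub>K\<^esub>)" "l \<noteq> []" "K.eval l x = 0"
    using K.algebraicE[OF subfieldE(1)[OF F], of x] by auto
  then have "set l \<subseteq> F" "hd l \<noteq> 0"
    by (auto simp: univ_poly_def polynomial_def)
  have "Poly (rev l) \<noteq> 0"
  proof
    assume "Poly (rev l) = 0"
    then obtain n where "rev l = replicate n 0" by (auto simp: Poly_eq_0)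
    then have "l = replicate n 0" by (metis rev_replicate rev_rev_ident)
    then show False using \<open>hd l \<noteq> 0\<close> \<open>l \<noteq> []\<close> by (cases n) auto
  qed
  moreover have "coeff (Poly (rev l)) i \<in> F" for i
    using \<open>set l \<subseteq> F\<close> subringE(2)[OF subfieldE(1)[OF F]] nth_mem[of i "rev l"]
    by (auto simp: nth_default_def)
  ultimately show "alg_over F x" using l(3) unfolding alg_over_def type_algebra_eval by blast
next
  assume "alg_over F x"
  then obtain p where p: "p \<noteq> 0" "\<And>i. coeff p i \<in> F" "poly p x = 0"
    unfolding alg_over_def by blast
  show "(K.algebraic over F) x"
  proof (rule K.algebraicI[of "rev (coeffs p)"])
    show "rev (coeffs p) \<in> carrier (F [X]\<^bsub>K\<^esub>)"
      using p by (auto simp: univ_poly_def polynomial_def coeffs_def hd_rev last_coeffs_eq_coeff_degree)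
  qed (use p in \<open>auto simp: type_algebra_eval\<close>)
qed

lemma subfield_set_iff: "subfield F K \<longleftrightarrow> subring_set F \<and> (\<forall>x\<in>F. inverse x \<in> F)"
proof (intro iffI conjI)
  assume F: "subfield F K"
  show "subring_set F"
    using subringE[OF subfieldE(1)[OF F]] by (auto simp: subring_set_def simp flip: add_uminus_conv_diff)
  show "\<forall>x\<in>F. inverse x \<in> F"
  proof
    fix x assume "x \<in> F"
    then show "inverse x \<in> F"
      using K.subfield_m_inv(1)[OF F, of x] subringE(2)[OF subfieldE(1)[OF F]] by (cases "x = 0") auto
  qed
next
  assume F: "subring_set F \<and> (\<forall>x\<in>F. inverse x \<in> F)"
  then have F': "subring_set F" by simp
  show "subfield F K"
    by (rule K.subfieldI', rule K.subringI)
      (use F in \<open>auto intro: subring_set_1[OF F'] subring_set_mult[OF F'] subring_set_add[OF F'] subring_set_uminus[OF F']\<close>)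
qed

lemma subring_set_alg_over_subfield:
  assumes "subfield F K"
  shows "subring_set {x. alg_over F x}"
  using K.subfield_of_algebraics[OF assms] by (simp add: subfield_set_iff type_algebra_algebraic[OF assms])

text \<open>Adjoining the finitely many coefficients of an equation for \<open>x\<close>, and then
  \<open>x\<close> itself, gives an extension of finite degree over \<open>F\<close>, and such
  extensions are algebraic.\<close>

lemma alg_over_subfield_trans:
  assumes F: "subfield F K" and x: "alg_over {y. alg_over F y} x"
  shows "alg_over F x"
proof -
  obtain p where p: "p \<noteq> 0" "\<And>i. alg_over F (coeff p i)" "poly p x = 0"
    using x unfolding alg_over_def[of _ x] by auto
  define E where "E = K.finite_extension F (coeffs p)"
  have cs: "(K.algebraic over F) c" if "c \<in> set (coeffs p)" for c
    using that p(2) by (auto simp: type_algebra_algebraic[OF F] elim!: set_coeffsE)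
  have E: "subfield E K" unfolding E_def
    by (rule K.finite_extension_is_subfield[OF F]) (use cs in auto)
  have fin: "K.finite_dimension F E" unfolding E_def
    by (rule K.finite_extension_finite_dimension(1)[OF F]) (use cs in auto)
  have "set (coeffs p) \<subseteq> E" unfolding E_def
    using K.finite_extension_mem[OF subfieldE(1)[OF F]] by simp
  then have "coeff p i \<in> E" for i
    using range_coeff[of p] subringE(2)[OF subfieldE(1)[OF E]] by (metis type_algebra_simps(2) insert_subset rangeI subsetD)
  then have x: "(K.algebraic over E) x"
    using p unfolding type_algebra_algebraic[OF E] alg_over_def by blast
  define S where "S = K.simple_extension E x"
  have "subfield S K" "K.finite_dimension E S" "x \<in> S"
    unfolding S_def
    using x K.simple_extension_is_subfield[OF E, of x] K.finite_dimension_simple_extension[OF E, of x]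
      K.simple_extension_mem[OF subfieldE(1)[OF E], of x] by auto
  then have "K.finite_dimension F S"
    using K.telescopic_base_dim(1)[OF F E fin] by blast
  then show ?thesis
    using K.finite_dimension_imp_algebraic[OF F subfieldE(1)[OF \<open>subfield S K\<close>]] \<open>x \<in> S\<close> type_algebra_algebraic[OF F] by blast
qed

end

section \<open>Fraction fields and algebraicity over subrings\<close>

definition fractions :: "'a::field set \<Rightarrow> 'a set" where
  "fractions A = {a / b | a b. a \<in> A \<and> b \<in> A}"

context
  fixes A :: "'a::field set"
  assumes A: "subring_set A"
begin

lemma fractions_superset: "A \<subseteq> fractions A"
proof
  fix x assume "x \<in> A"
  then show "x \<in> fractions A"
    unfolding fractions_def using subring_set_1[OF A] by (intro CollectI exI[of _ x] exI[of _ 1]) auto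
qed

lemma subring_set_fractions: "subring_set (fractions A)"
  unfolding subring_set_def
proof (intro conjI ballI)
  show "1 \<in> fractions A" using fractions_superset subring_set_1[OF A] by blast
  fix x y assume "x \<in> fractions A" "y \<in> fractions A"
  then obtain a b c d where x: "x = a / b" "a \<in> A" "b \<in> A" and y: "y = c / d" "c \<in> A" "d \<in> A"
    unfolding fractions_def by blast
  have "x * y = (a * c) / (b * d)" by (simp add: x y)
  then show "x * y \<in> fractions A"
    unfolding fractions_def using x y subring_set_mult[OF A] by blast
  \<comment> \<open>\<open>fractions\<close> admits the denominator 0; such a quotient is 0 by
    convention, and the difference then has a single summand.\<close>
  consider "b = 0" | "d = 0" | "b \<noteq> 0" "d \<noteq> 0" by blast
  then show "x - y \<in> fractions A"
  proof cases
    case 1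
    then have "x - y = (- c) / d" by (simp add: x y)
    then show ?thesis unfolding fractions_def using y subring_set_uminus[OF A] by blast
  next
    case 2
    then have "x - y = a / b" by (simp add: x y)
    then show ?thesis unfolding fractions_def using x by blast
  next
    case 3
    then have "x - y = (a * d - c * b) / (b * d)" by (simp add: x y diff_frac_eq)
    moreover have "a * d - c * b \<in> A" "b * d \<in> A"
      using x y by (auto intro!: subring_set_mult[OF A] subring_set_diff[OF A])
    ultimately show ?thesis
      unfolding fractions_def by blast
  qed
qed

lemma subfield_fractions: "subfield (fractions A) ring_of_type_algebra"
  unfolding subfield_set_iff using subring_set_fractions by (auto simp: fractions_def) (metis inverse_divide)

lemma common_denominator:
  assumes "finite S" "S \<subseteq> fractions A"
  shows "\<exists>d\<in>A. d \<noteq> 0 \<and> (\<forall>s\<in>S. d * s \<in> A)"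
  using assms
proof (induction S rule: finite_induct)
  case empty
  then show ?case using subring_set_1[OF A] by (intro bexI[of _ 1]) auto
next
  case (insert x S)
  then obtain d where d: "d \<in> A" "d \<noteq> 0" "\<forall>s\<in>S. d * s \<in> A" by auto
  from insert obtain a b where x: "x = a / b" "a \<in> A" "b \<in> A" by (auto simp: fractions_def)
  \<comment> \<open>If \<open>b = 0\<close> then \<open>x = 0\<close>, and 1 serves as its
    denominator.\<close>
  define b' where "b' = (if b = 0 then 1 else b)"
  have b': "b' \<in> A" "b' \<noteq> 0" "b' * x \<in> A"
    using x subring_set_1[OF A] subring_set_0[OF A] by (auto simp: b'_def)
  have "d * b' * s \<in> A" if "s \<in> insert x S" for s
  proof (cases "s = x")
    case True
    then show ?thesis using subring_set_mult[OF A d(1) b'(3)] by (simp add: mult_ac)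
  next
    case False
    then have "d * s \<in> A" using that d by blast
    then show ?thesis using subring_set_mult[OF A b'(1), of "d * s"] by (simp add: mult_ac)
  qed
  then show ?case using d b' subring_set_mult[OF A] by (intro bexI[of _ "d * b'"]) auto
qed

text \<open>An equation over the fraction field is multiplied by a common denominator of its
  coefficients.\<close>

lemma alg_over_fractions: "alg_over (fractions A) x \<longleftrightarrow> alg_over A x"
proof
  assume "alg_over (fractions A) x"
  then obtain p where p: "p \<noteq> 0" "\<And>i. coeff p i \<in> fractions A" "poly p x = 0"
    unfolding alg_over_def by blast
  obtain d where d: "d \<in> A" "d \<noteq> 0" "\<forall>s\<in>set (coeffs p). d * s \<in> A"
    using common_denominator[of "set (coeffs p)"] p(2) by (blast elim: set_coeffsE)
  have "coeff (smult d p) i \<in> A" for i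
    using d(3) range_coeff[of p] subring_set_0[OF A] by (cases "coeff p i = 0") auto
  then show "alg_over A x"
    using p d(2) unfolding alg_over_def by (intro exI[of _ "smult d p"]) auto
qed (rule alg_over_mono[OF _ fractions_superset])

lemma subring_set_alg_over: "subring_set {x. alg_over A x}"
  using subring_set_alg_over_subfield[OF subfield_fractions] by (simp add: alg_over_fractions)

lemma alg_over_trans:
  assumes "B \<subseteq> {y. alg_over A y}" "alg_over B x"
  shows "alg_over A x"
  using alg_over_subfield_trans[OF subfield_fractions] alg_over_mono[OF assms(2,1)]
  by (simp add: alg_over_fractions)

end


section \<open>Extending isomorphisms to algebraically closed fields\<close>

text \<open>An isomorphism between subrings is represented by its graph.\<close>

definition iso_graph :: "('a::comm_ring_1 \<times> 'a) set \<Rightarrow> bool" where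
  "iso_graph G \<longleftrightarrow> (1, 1) \<in> G \<and>
     (\<forall>a b c d. (a, b) \<in> G \<longrightarrow> (c, d) \<in> G \<longrightarrow> (a - c, b - d) \<in> G \<and> (a * c, b * d) \<in> G) \<and>
     (\<forall>a b. (a, b) \<in> G \<longrightarrow> (a = 0 \<longleftrightarrow> b = 0))"

definition poly_graph :: "('a::comm_ring_1 \<times> 'a) set \<Rightarrow> ('a poly \<times> 'a poly) set" where
  "poly_graph G = {(P, Q). \<forall>i. (coeff P i, coeff Q i) \<in> G}"

text \<open>The condition on zeros, applied to differences, makes a graph single-valued in both
  directions. By this symmetry, surjectivity of an isomorphism is totality of the converse
  graph.\<close>

lemma iso_graph_converse: "iso_graph G \<Longrightarrow> iso_graph (G\<inverse>)"
  by (simp add: iso_graph_def)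

lemma degree_pos_of_root: "p \<noteq> 0 \<Longrightarrow> poly p x = 0 \<Longrightarrow> degree p > 0"
  for p :: "'a::comm_ring_1 poly"
  by (rule ccontr) (auto elim: degree_eq_zeroE)

context
  fixes G :: "('a::field \<times> 'a) set"
  assumes G: "iso_graph G"
begin

lemma graph_1: "(1, 1) \<in> G"
  and graph_diff: "(a, b) \<in> G \<Longrightarrow> (c, d) \<in> G \<Longrightarrow> (a - c, b - d) \<in> G"
  and graph_mult: "(a, b) \<in> G \<Longrightarrow> (c, d) \<in> G \<Longrightarrow> (a * c, b * d) \<in> G"
  and graph_zero_iff: "(a, b) \<in> G \<Longrightarrow> a = 0 \<longleftrightarrow> b = 0"
  using G unfolding iso_graph_def by blast+

lemma graph_0: "(0, 0) \<in> G"
  using graph_diff[OF graph_1 graph_1] by simp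

lemma graph_add: "(a, b) \<in> G \<Longrightarrow> (c, d) \<in> G \<Longrightarrow> (a + c, b + d) \<in> G"
  using graph_diff[of a b "0 - c" "0 - d"] graph_diff[OF graph_0, of c d] by simp

lemma graph_sum: "(\<And>i. i \<in> I \<Longrightarrow> (f i, g i) \<in> G) \<Longrightarrow> (sum f I, sum g I) \<in> G"
  by (induction I rule: infinite_finite_induct) (auto intro: graph_0 graph_add)

lemma poly_graph_coeff: "(P, Q) \<in> poly_graph G \<Longrightarrow> (coeff P i, coeff Q i) \<in> G"
  by (simp add: poly_graph_def)

lemma poly_graph_diff:
  "(P, Q) \<in> poly_graph G \<Longrightarrow> (P', Q') \<in> poly_graph G \<Longrightarrow> (P - P', Q - Q') \<in> poly_graph G"
  by (auto simp: poly_graph_def intro: graph_diff)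

lemma poly_graph_mult:
  "(P, Q) \<in> poly_graph G \<Longrightarrow> (P', Q') \<in> poly_graph G \<Longrightarrow> (P * P', Q * Q') \<in> poly_graph G"
  by (auto simp: poly_graph_def coeff_mult intro!: graph_sum graph_mult)

lemma poly_graph_monom: "(a, b) \<in> G \<Longrightarrow> (monom a n, monom b n) \<in> poly_graph G"
  using graph_0 by (auto simp: poly_graph_def)

lemma poly_graph_zero: "(0, 0) \<in> poly_graph G"
  using graph_0 by (auto simp: poly_graph_def)

lemma poly_graph_add:
  assumes "(P, Q) \<in> poly_graph G" "(P', Q') \<in> poly_graph G"
  shows "(P + P', Q + Q') \<in> poly_graph G"
  using assms by (auto simp: poly_graph_def intro: graph_add)

lemma poly_graph_coeff_eq_0:
  "(P, Q) \<in> poly_graph G \<Longrightarrow> coeff P i = 0 \<longleftrightarrow> coeff Q i = 0"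
  using graph_zero_iff poly_graph_coeff by blast

lemma poly_graph_eq_0: "(P, Q) \<in> poly_graph G \<Longrightarrow> P = 0 \<longleftrightarrow> Q = 0"
  by (simp add: poly_eq_iff poly_graph_coeff_eq_0)

lemma poly_graph_degree: "(P, Q) \<in> poly_graph G \<Longrightarrow> degree P = degree Q"
  by (simp add: Polynomial.degree_def poly_graph_coeff_eq_0)

text \<open>Used to see that a maximal graph is closed under inverses, so that its domain is a
  field.\<close>

lemma iso_graph_fractions: "iso_graph {(a / c, b / d) | a b c d. (a, b) \<in> G \<and> (c, d) \<in> G \<and> c \<noteq> 0}"
  (is "iso_graph ?H")
proof -
  have I: "(u, v) \<in> ?H" if "(a, b) \<in> G" "(c, d) \<in> G" "c \<noteq> 0" "u = a / c" "v = b / d" for u v a b c d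
    using that by blast
  show ?thesis
    unfolding iso_graph_def
  proof (intro conjI allI impI)
    show "(1, 1) \<in> ?H" by (rule I[OF graph_1 graph_1]) auto
  next
    fix u v u' v' assume "(u, v) \<in> ?H" "(u', v') \<in> ?H"
    then obtain a b c d a' b' c' d' where
      1: "(a, b) \<in> G" "(c, d) \<in> G" "c \<noteq> 0" "u = a / c" "v = b / d" and
      2: "(a', b') \<in> G" "(c', d') \<in> G" "c' \<noteq> 0" "u' = a' / c'" "v' = b' / d'"
      by blast
    have d: "d \<noteq> 0" "d' \<noteq> 0" using 1 2 graph_zero_iff by blast+
    show "(u * u', v * v') \<in> ?H"
      by (rule I[OF graph_mult[OF 1(1) 2(1)] graph_mult[OF 1(2) 2(2)]]) (use 1 2 in auto)
    show "(u - u', v - v') \<in> ?H"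
      by (rule I[OF graph_diff[OF graph_mult[OF 1(1) 2(2)] graph_mult[OF 2(1) 1(2)]] graph_mult[OF 1(2) 2(2)]])
        (use 1 2 d in \<open>auto simp: diff_frac_eq\<close>)
  next
    fix u v assume "(u, v) \<in> ?H"
    then show "u = 0 \<longleftrightarrow> v = 0" using graph_zero_iff by auto
  qed
qed

end

context
  fixes G :: "('a::field \<times> 'a) set"
  assumes G: "iso_graph G" and inv: "\<And>a b. (a, b) \<in> G \<Longrightarrow> (inverse a, inverse b) \<in> G"
begin

text \<open>Euclidean division runs in parallel on both sides: corresponding polynomials have equal
  degrees and corresponding leading coefficients, whose quotients correspond by closure under
  inverses.\<close>

lemma poly_graph_division:
  assumes P: "(P, Q) \<in> poly_graph G" "P \<noteq> 0" and A: "(A, B) \<in> poly_graph G"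
  shows "\<exists>S T R U. (S, T) \<in> poly_graph G \<and> (R, U) \<in> poly_graph G \<and> A = S * P + R \<and> B = T * Q + U \<and>
    (R = 0 \<or> degree R < degree P)"
  using A
\<comment> \<open>The measure separates 0 from nonzero constants, which have the same
  degree.\<close>
proof (induction "if A = 0 then 0 else Suc (degree A)" arbitrary: A B rule: less_induct)
  case less
  show ?case
  proof (cases "A = 0 \<or> degree A < degree P")
    case True
    then show ?thesis
      using less.prems poly_graph_zero[OF G] by (intro exI[of _ 0] exI[of _ A] exI[of _ B]) auto
  next
    case False
    define n where "n = degree A - degree P"
    define c where "c = lead_coeff A * inverse (lead_coeff P)"
    define d where "d = lead_coeff B * inverse (lead_coeff Q)"
    have deg: "degree A = degree B" "degree P = degree Q"
      using poly_graph_degree[OF G] less.prems P by blast+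
    have "(c, d) \<in> G" unfolding c_def d_def deg
      by (intro graph_mult[OF G] inv poly_graph_coeff[OF G]) (use less.prems P in \<open>auto simp: deg\<close>)
    then have cd: "(monom c n, monom d n) \<in> poly_graph G" by (rule poly_graph_monom[OF G])
    define A' where "A' = A - monom c n * P"
    define B' where "B' = B - monom d n * Q"
    have AB: "(A', B') \<in> poly_graph G" unfolding A'_def B'_def
      by (intro poly_graph_diff[OF G] poly_graph_mult[OF G] cd P less.prems)
    have "degree (monom c n * P) \<le> degree A"
      using degree_mult_le[of "monom c n" P] degree_monom_le[of c n] False unfolding n_def by linarith
    then have "degree A' \<le> degree A" unfolding A'_def by (intro degree_diff_le) auto
    moreover have "coeff A' (degree A) = 0"
      using False P(2) by (simp add: A'_def coeff_monom_mult n_def c_def)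
    ultimately have "A' = 0 \<or> degree A' < degree A" by (rule eq_zero_or_degree_less)
    then have "(if A' = 0 then 0 else Suc (degree A')) < (if A = 0 then 0 else Suc (degree A))"
      using False by auto
    from less.hyps[OF this AB] obtain S T R U where *: "(S, T) \<in> poly_graph G" "(R, U) \<in> poly_graph G"
      "A' = S * P + R" "B' = T * Q + U" "R = 0 \<or> degree R < degree P" by blast
    have "A = (S + monom c n) * P + R" "B = (T + monom d n) * Q + U"
      using *(3,4) by (simp_all add: A'_def B'_def algebra_simps)
    then show ?thesis using *(2,5) poly_graph_add[OF G *(1) cd] by blast
  qed
qed

text \<open>The hypothesis says that evaluation at \<open>x\<close> and evaluation at
  \<open>y\<close> have corresponding kernels, which makes sending \<open>x\<close> to
  \<open>y\<close> well defined and injective.\<close>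

lemma iso_graph_adjoin:
  fixes x y :: 'a
  assumes "\<And>A B. (A, B) \<in> poly_graph G \<Longrightarrow> poly A x = 0 \<longleftrightarrow> poly B y = 0"
  shows "iso_graph {(poly A x, poly B y) | A B. (A, B) \<in> poly_graph G}" (is "iso_graph ?H")
proof -
  have I: "(u, v) \<in> ?H" if "(A, B) \<in> poly_graph G" "u = poly A x" "v = poly B y" for A B u v
    using that by blast
  show ?thesis
    unfolding iso_graph_def
  proof (intro conjI allI impI)
    show "(1, 1) \<in> ?H"
      by (rule I[OF poly_graph_monom[OF G graph_1[OF G], of 0]]) (auto simp: poly_monom)
  next
    fix u v u' v' assume "(u, v) \<in> ?H" "(u', v') \<in> ?H"
    then obtain A B A' B' where 1: "(A, B) \<in> poly_graph G" "(A', B') \<in> poly_graph G"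
      "u = poly A x" "v = poly B y" "u' = poly A' x" "v' = poly B' y"
      by blast
    show "(u - u', v - v') \<in> ?H" by (rule I[OF poly_graph_diff[OF G 1(1,2)]]) (auto simp: 1)
    show "(u * u', v * v') \<in> ?H" by (rule I[OF poly_graph_mult[OF G 1(1,2)]]) (auto simp: 1)
  next
    fix u v assume "(u, v) \<in> ?H"
    then show "u = 0 \<longleftrightarrow> v = 0" by (auto simp: assms)
  qed
qed

text \<open>\<open>P\<close> is the minimal polynomial of \<open>x\<close> up to a scalar. If
  \<open>A\<close> vanishes at \<open>x\<close>, its remainder modulo \<open>P\<close> is 0, and so
  is the corresponding remainder of \<open>B\<close>. The converse is in essence irreducibility of
  \<open>Q\<close>, argued on the side of \<open>P\<close>, where minimality is available.\<close>

lemma minimal_poly_graph_root: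
  fixes x y :: 'a
  assumes P: "(P, Q) \<in> poly_graph G" "P \<noteq> 0" "poly P x = 0" "poly Q y = 0"
    and min: "\<And>A B. (A, B) \<in> poly_graph G \<Longrightarrow> A \<noteq> 0 \<Longrightarrow> poly A x = 0 \<Longrightarrow> degree P \<le> degree A"
    and A: "(A, B) \<in> poly_graph G"
  shows "poly A x = 0 \<longleftrightarrow> poly B y = 0"
proof
  obtain S T R U where d: "(S, T) \<in> poly_graph G" "(R, U) \<in> poly_graph G"
    "A = S * P + R" "B = T * Q + U" "R = 0 \<or> degree R < degree P"
    using poly_graph_division[OF P(1,2) A] by blast
  assume "poly A x = 0"
  then have "poly R x = 0" using P by (simp add: d)
  with min[OF d(2)] d(5) have "R = 0" by force
  then have "U = 0" using poly_graph_eq_0[OF G d(2)] by simp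
  then show "poly B y = 0" using P by (simp add: d)
next
  assume B: "poly B y = 0"
  show "poly A x = 0"
  proof (rule ccontr)
    assume nz: "poly A x \<noteq> 0"
    \<comment> \<open>A counterexample of least degree would properly divide \<open>P\<close>, contradicting minimality of \<open>P\<close>.\<close>
    define W where "W = {(A, B). (A, B) \<in> poly_graph G \<and> poly B y = 0 \<and> poly A x \<noteq> 0}"
    have "(A, B) \<in> W" using A B nz by (simp add: W_def)
    then obtain w where w: "w \<in> W" "\<And>w'. w' \<in> W \<Longrightarrow> degree (fst w) \<le> degree (fst w')"
      using ex_has_least_nat[of "\<lambda>w. w \<in> W" _ "\<lambda>w. degree (fst w)"] by blast
    obtain M N where "w = (M, N)" by fastforce
    with w(1) have M: "(M, N) \<in> poly_graph G" "poly N y = 0" "poly M x \<noteq> 0" by (auto simp: W_def)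
    have Mmin: "degree M \<le> degree A" if "(A, B) \<in> poly_graph G" "poly B y = 0" "poly A x \<noteq> 0" for A B
      using w(2)[of "(A, B)"] that \<open>w = (M, N)\<close> by (auto simp: W_def)
    have "M \<noteq> 0" using M by auto
    \<comment> \<open>Reduction modulo \<open>P\<close> and \<open>Q\<close> changes neither value,
      so the remainder is again a counterexample.\<close>
    have red: "degree M < degree P"
    proof -
      obtain S T R U where d: "(S, T) \<in> poly_graph G" "(R, U) \<in> poly_graph G"
        "M = S * P + R" "N = T * Q + U" "R = 0 \<or> degree R < degree P"
        using poly_graph_division[OF P(1,2) M(1)] by blast
      have "poly R x \<noteq> 0" "poly U y = 0" using M P by (simp_all add: d)
      with Mmin[OF d(2)] d(5) show ?thesis by force
    qed
    have "degree N = degree M" "N \<noteq> 0" using poly_graph_degree[OF G M(1)] poly_graph_eq_0[OF G M(1)] \<open>M \<noteq> 0\<close> by auto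
    then have "degree M > 0" using degree_pos_of_root[of N y] M(2) by simp
    obtain S T R U where d: "(S, T) \<in> poly_graph G" "(R, U) \<in> poly_graph G"
      "P = S * M + R" "Q = T * N + U" "R = 0 \<or> degree R < degree M"
      using poly_graph_division[OF M(1) \<open>M \<noteq> 0\<close> P(1)] by blast
    have "poly U y = 0" using P M by (simp add: d)
    \<comment> \<open>A nonzero \<open>R\<close> has degree below \<open>M\<close>, so it is no
      counterexample and vanishes at \<open>x\<close>; but its degree is also below that of
      \<open>P\<close>.\<close>
    have "R = 0"
    proof (rule ccontr)
      assume "R \<noteq> 0"
      with d(5) have less: "degree R < degree M" by simp
      then have "poly R x = 0" using Mmin[OF d(2)] \<open>poly U y = 0\<close> by force
      then show False using min[OF d(2) \<open>R \<noteq> 0\<close>] less red by simp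
    qed
    then have PSM: "P = S * M" using d by simp
    then have "S \<noteq> 0" using P by auto
    have "poly S x = 0" using P(3) M(3) by (simp add: PSM)
    then have "degree P \<le> degree S" using min[OF d(1) \<open>S \<noteq> 0\<close>] by simp
    moreover have "degree P = degree S + degree M"
      unfolding PSM using \<open>S \<noteq> 0\<close> \<open>M \<noteq> 0\<close> by (rule degree_mult_eq)
    ultimately show False using \<open>degree M > 0\<close> by simp
  qed
qed

end

text \<open>A relation of least degree for \<open>x\<close> corresponds to a polynomial of the same
  positive degree, which has a root \<open>y\<close> because the field is algebraically closed;
  \<open>x\<close> can then be sent to \<open>y\<close>.\<close>

lemma iso_graph_extend:
  fixes G :: "('a::alg_closed_field \<times> 'a) set"
  assumes G: "iso_graph G" and inv: "\<And>a b. (a, b) \<in> G \<Longrightarrow> (inverse a, inverse b) \<in> G"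
    and P: "(P, Q) \<in> poly_graph G" "P \<noteq> 0" "poly P x = 0"
  shows "\<exists>H y. iso_graph H \<and> G \<subseteq> H \<and> (x, y) \<in> H"
proof -
  define W where "W = {(A, B). (A, B) \<in> poly_graph G \<and> A \<noteq> 0 \<and> poly A x = 0}"
  have "(P, Q) \<in> W" using P by (simp add: W_def)
  then obtain w where w: "w \<in> W" "\<And>w'. w' \<in> W \<Longrightarrow> degree (fst w) \<le> degree (fst w')"
    using ex_has_least_nat[of "\<lambda>w. w \<in> W" _ "\<lambda>w. degree (fst w)"] by blast
  obtain M N where "w = (M, N)" by fastforce
  with w(1) have M: "(M, N) \<in> poly_graph G" "M \<noteq> 0" "poly M x = 0" by (auto simp: W_def)
  have Mmin: "degree M \<le> degree A" if "(A, B) \<in> poly_graph G" "A \<noteq> 0" "poly A x = 0" for A B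
    using w(2)[of "(A, B)"] that \<open>w = (M, N)\<close> by (auto simp: W_def)
  have "degree M > 0" using degree_pos_of_root M(2,3) .
  then have "degree N > 0" using poly_graph_degree[OF G M(1)] by simp
  then obtain y where y: "poly N y = 0" using alg_closed_imp_poly_has_root[of N] by auto
  define H where "H = {(poly A x, poly B y) | A B. (A, B) \<in> poly_graph G}"
  have "iso_graph H" unfolding H_def
    by (rule iso_graph_adjoin[OF G inv]) (assumption, rule minimal_poly_graph_root[OF G inv M y Mmin])
  moreover have "G \<subseteq> H"
  proof
    fix z assume "z \<in> G"
    then have "(monom (fst z) 0, monom (snd z) 0) \<in> poly_graph G" by (intro poly_graph_monom[OF G]) auto
    then have "(poly (monom (fst z) 0) x, poly (monom (snd z) 0) y) \<in> H" unfolding H_def by blast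
    then show "z \<in> H" by (simp add: poly_monom)
  qed
  moreover have "(x, y) \<in> H"
  proof -
    have "(poly (monom 1 1) x, poly (monom 1 1) y) \<in> H"
      unfolding H_def using poly_graph_monom[OF G graph_1[OF G]] by blast
    then show ?thesis by (simp add: poly_monom)
  qed
  ultimately show ?thesis by blast
qed

text \<open>Maximality first makes the graph closed under inverses, through its extension to
  fractions; then an algebraic \<open>x\<close> outside the domain would allow a proper
  extension.\<close>

lemma maximal_iso_graph_domain:
  fixes G :: "('a::alg_closed_field \<times> 'a) set"
  assumes G: "iso_graph G" and max: "\<And>H. iso_graph H \<Longrightarrow> G \<subseteq> H \<Longrightarrow> H = G"
    and x: "alg_over (Domain G) x"
  shows "x \<in> Domain G"
proof -
  have inv: "(inverse a, inverse b) \<in> G" if ab: "(a, b) \<in> G" for a b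
  proof (cases "a = 0")
    case True
    then show ?thesis using ab graph_zero_iff[OF G ab] by simp
  next
    case False
    let ?H = "{(a / c, b / d) | a b c d. (a, b) \<in> G \<and> (c, d) \<in> G \<and> c \<noteq> 0}"
    have "G \<subseteq> ?H"
    proof
      fix z assume "z \<in> G"
      then show "z \<in> ?H" using graph_1[OF G]
        by (intro CollectI exI[of _ "fst z"] exI[of _ "snd z"] exI[of _ 1]) auto
    qed
    then have "?H = G" by (rule max[OF iso_graph_fractions[OF G]])
    moreover have "(1 / a, 1 / b) \<in> ?H"
      by (intro CollectI exI conjI) (rule refl, rule graph_1[OF G], rule ab, rule False)
    ultimately show ?thesis by (simp add: inverse_eq_divide)
  qed
  obtain P where P: "P \<noteq> 0" "\<And>i. coeff P i \<in> Domain G" "poly P x = 0"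
    using x unfolding alg_over_def by blast
  define f where "f a = (SOME b. (a, b) \<in> G)" for a
  have f: "(a, f a) \<in> G" if "a \<in> Domain G" for a
    using that unfolding f_def by (auto intro: someI)
  \<comment> \<open>\<open>map_poly\<close> acts coefficientwise only for functions that fix
    0.\<close>
  have "f 0 = 0" using f[of 0] graph_0[OF G] graph_zero_iff[OF G] by blast
  then have "(P, map_poly f P) \<in> poly_graph G"
    using P(2) f by (auto simp: poly_graph_def coeff_map_poly)
  from iso_graph_extend[OF G inv this P(1,3)] obtain H y where "iso_graph H" "G \<subseteq> H" "(x, y) \<in> H"
    by auto
  moreover have "H = G" by (rule max) fact+
  ultimately show ?thesis by blast
qed

text \<open>The argument for uniqueness of algebraic closures: a graph maximal above the pairs
  \<open>(i r, b r)\<close> exists by Zorn's lemma. It is total since everything is algebraic over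
  the range of \<open>i\<close>, and onto since everything is algebraic over the range of
  \<open>b\<close>.\<close>

theorem extend_to_automorphism:
  fixes i b :: "'r::comm_ring_1 \<Rightarrow> 'a::alg_closed_field"
  assumes i: "ring_map i" "inj i" and b: "ring_map b" "inj b"
    and algi: "\<And>x. alg_over (range i) x" and algb: "\<And>x. alg_over (range b) x"
  shows "\<exists>\<tau>. ring_map \<tau> \<and> bij \<tau> \<and> (\<forall>r. \<tau> (i r) = b r)"
proof -
  interpret i: ring_map i by fact
  interpret b: ring_map b by fact
  define G0 where "G0 = range (\<lambda>r. (i r, b r))"
  have i0: "i r = 0 \<longleftrightarrow> r = 0" for r using i(2) i.zero by (metis injD)
  have b0: "b r = 0 \<longleftrightarrow> r = 0" for r using b(2) b.zero by (metis injD)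
  have G0: "iso_graph G0"
    unfolding iso_graph_def
  proof (intro conjI allI impI)
    show "(1, 1) \<in> G0" unfolding G0_def by (rule range_eqI[of _ _ 1]) simp
    fix a a' c c' assume "(a, a') \<in> G0" "(c, c') \<in> G0"
    then obtain r s where "a = i r" "a' = b r" "c = i s" "c' = b s" by (auto simp: G0_def)
    then show "(a - c, a' - c') \<in> G0" "(a * c, a' * c') \<in> G0"
      unfolding G0_def by (auto simp flip: i.diff b.diff i.mult b.mult)
  qed (auto simp: G0_def i0 b0)
  define W where "W = {G. iso_graph G \<and> G0 \<subseteq> G}"
  have "\<exists>M\<in>W. \<forall>Y\<in>W. M \<subseteq> Y \<longrightarrow> Y = M"
  proof (rule subset_Zorn_nonempty)
    show "W \<noteq> {}" using G0 by (auto simp: W_def)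
    fix C assume chain: "C \<noteq> {}" "subset.chain W C"
    then have iso: "iso_graph G" "G0 \<subseteq> G" if "G \<in> C" for G
      using that by (auto simp: subset.chain_def W_def)
    have two: "\<exists>G\<in>C. u \<in> G \<and> v \<in> G" if "u \<in> \<Union>C" "v \<in> \<Union>C" for u v
      using that chain(2) unfolding subset.chain_def by blast
    have "iso_graph (\<Union>C)"
      unfolding iso_graph_def
    proof (intro conjI allI impI)
      show "(1, 1) \<in> \<Union>C" using chain(1) iso graph_1 by blast
      fix a a' c c' assume "(a, a') \<in> \<Union>C" "(c, c') \<in> \<Union>C"
      then obtain G where "G \<in> C" "(a, a') \<in> G" "(c, c') \<in> G" using two by blast
      then show "(a - c, a' - c') \<in> \<Union>C" "(a * c, a' * c') \<in> \<Union>C"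
        using iso graph_diff[of G] graph_mult[of G] by blast+
    next
      fix a a' assume "(a, a') \<in> \<Union>C"
      then show "a = 0 \<longleftrightarrow> a' = 0" using iso graph_zero_iff by blast
    qed
    moreover have "G0 \<subseteq> \<Union>C" using chain(1) iso by blast
    ultimately show "\<Union>C \<in> W" by (simp add: W_def)
  qed
  then obtain G where G: "iso_graph G" "G0 \<subseteq> G" and max: "\<And>H. iso_graph H \<Longrightarrow> G \<subseteq> H \<Longrightarrow> H = G"
    by (auto simp: W_def)
  have dom: "x \<in> Domain G" for x
  proof (rule maximal_iso_graph_domain[OF G(1) max])
    show "alg_over (Domain G) x"
      by (rule alg_over_mono[OF algi]) (use G(2) in \<open>auto simp: G0_def\<close>)
  qed
  \<comment> \<open>The converse of a maximal graph is maximal, so the argument for the domain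
    applies to it.\<close>
  have ran: "x \<in> Domain (G\<inverse>)" for x
  proof (rule maximal_iso_graph_domain[OF iso_graph_converse[OF G(1)]])
    show "H = G\<inverse>" if "iso_graph H" "G\<inverse> \<subseteq> H" for H
    proof -
      have "G \<subseteq> H\<inverse>" using that(2) by auto
      then have "H\<inverse> = G" by (rule max[OF iso_graph_converse[OF that(1)]])
      then show ?thesis by auto
    qed
    show "alg_over (Domain (G\<inverse>)) x"
      by (rule alg_over_mono[OF algb]) (use G(2) in \<open>auto simp: G0_def\<close>)
  qed
  have fn: "y = y'" if "(x, y) \<in> G" "(x, y') \<in> G" for x y y'
    using graph_zero_iff[OF G(1) graph_diff[OF G(1) that]] by simp
  have inj: "x = x'" if "(x, y) \<in> G" "(x', y) \<in> G" for x x' y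
    using graph_zero_iff[OF G(1) graph_diff[OF G(1) that]] by simp
  define \<tau> where "\<tau> x = (SOME y. (x, y) \<in> G)" for x
  have \<tau>: "(x, \<tau> x) \<in> G" for x
    using dom[of x] unfolding \<tau>_def by (auto intro: someI)
  have \<tau>I: "(x, y) \<in> G \<Longrightarrow> \<tau> x = y" for x y using fn \<tau> by blast
  have "ring_map \<tau>"
    by unfold_locales (rule \<tau>I, rule graph_1[OF G(1)], rule \<tau>I, rule graph_add[OF G(1) \<tau> \<tau>],
        rule \<tau>I, rule graph_mult[OF G(1) \<tau> \<tau>])
  moreover have "bij \<tau>"
  proof (rule bijI)
    show "inj \<tau>" by (rule injI) (metis \<tau> inj)
    show "surj \<tau>"
    proof (rule surjI[of _ "\<lambda>y. SOME x. (x, y) \<in> G"])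
      fix y show "\<tau> (SOME x. (x, y) \<in> G) = y"
        by (rule \<tau>I) (use ran[of y] in \<open>auto intro: someI\<close>)
    qed
  qed
  moreover have "\<tau> (i r) = b r" for r
    by (rule \<tau>I) (use G(2) in \<open>auto simp: G0_def\<close>)
  ultimately show ?thesis by blast
qed


section \<open>The algebraic closure of a rational function field in infinitely many variables\<close>

type_synonym 'a ambient = "((nat \<Rightarrow>\<^sub>0 nat) \<Rightarrow>\<^sub>0 'a) fract alg_closure"

definition amb :: "((nat \<Rightarrow>\<^sub>0 nat) \<Rightarrow>\<^sub>0 'a::field) \<Rightarrow> 'a ambient" where
  "amb r = to_ac (Fract r 1)"

definition amb_const :: "'a::field \<Rightarrow> 'a ambient" where
  "amb_const c = amb (mp_const c)"

definition amb_var :: "nat \<Rightarrow> 'a::field ambient" where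
  "amb_var j = amb (mp_var j)"

lemma ring_map_amb: "ring_map amb"
  by unfold_locales (simp_all add: amb_def flip: to_ac_add to_ac_mult One_fract_def)

interpretation amb: ring_map amb
  by (rule ring_map_amb)

lemma amb_eq_0 [simp]: "amb r = 0 \<longleftrightarrow> r = 0"
  by (simp add: amb_def Zero_fract_def eq_fract)

lemma inj_amb: "inj amb"
  by (rule amb.inj_onI_kernel) simp

interpretation amb_const: ring_map amb_const
  using ring_map_comp[OF ring_map_amb ring_map_const] by (simp add: amb_const_def[abs_def] o_def)

lemma inj_amb_var: "inj (amb_var :: nat \<Rightarrow> 'a::field ambient)"
proof (rule injI)
  fix i j assume "(amb_var i :: 'a ambient) = amb_var j"
  then have "(mp_var i :: (nat \<Rightarrow>\<^sub>0 nat) \<Rightarrow>\<^sub>0 'a) = mp_var j"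
    unfolding amb_var_def by (rule injD[OF inj_amb])
  then have "Poly_Mapping.keys (mp_var i :: (nat \<Rightarrow>\<^sub>0 nat) \<Rightarrow>\<^sub>0 'a) = Poly_Mapping.keys (mp_var j :: (nat \<Rightarrow>\<^sub>0 nat) \<Rightarrow>\<^sub>0 'a)"
    by simp
  then have "Poly_Mapping.keys (Poly_Mapping.single i (1 :: nat)) = Poly_Mapping.keys (Poly_Mapping.single j (1 :: nat))"
    by (simp add: mp_var_def)
  then show "i = j" by simp
qed

lemma mp_eval_amb: "mp_eval amb_const amb_var r = amb r"
  by (subst ring_map_eq_mp_eval[OF ring_map_amb]) (simp add: amb_const_def[abs_def] amb_var_def[abs_def])

text \<open>The closure is algebraic over the rational function field, whose elements are quotients
  of polynomials; \<open>alg_over_fractions\<close> clears the denominators.\<close>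

lemma alg_over_range_amb: "alg_over (range amb) x"
proof -
  obtain p where p: "p \<noteq> 0" "poly (map_poly to_ac p) x = 0"
    using alg_closure_algebraic[of x] by blast
  have S: "subring_set (range (amb :: _ \<Rightarrow> 'a ambient))"
    by (rule amb.subring_set_image[OF subring_set_UNIV])
  have "to_ac q \<in> fractions (range amb)" for q :: "((nat \<Rightarrow>\<^sub>0 nat) \<Rightarrow>\<^sub>0 'a) fract"
  proof (cases q)
    case (Fract a b)
    then have "to_ac q = amb a / amb b" by (simp add: amb_def flip: to_ac_divide)
    then show ?thesis unfolding fractions_def by blast
  qed
  moreover have "map_poly to_ac p \<noteq> 0" using p(1) by (simp add: map_poly_eq_0_iff)
  ultimately have "alg_over (fractions (range amb)) x"
    unfolding alg_over_def using p(2) by (intro exI[of _ "map_poly to_ac p"]) (simp add: coeff_map_poly)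
  then show ?thesis by (simp add: alg_over_fractions[OF S])
qed

definition amb_free :: "nat \<Rightarrow> 'a::field ambient set" where
  "amb_free p = amb ` {r. \<forall>m\<in>Poly_Mapping.keys r. Poly_Mapping.lookup m p = 0}"

lemma subring_set_amb_free: "subring_set (amb_free p)"
  unfolding amb_free_def
proof (rule amb.subring_set_image)
  show "subring_set {r :: (nat \<Rightarrow>\<^sub>0 nat) \<Rightarrow>\<^sub>0 'a. \<forall>m\<in>Poly_Mapping.keys r. Poly_Mapping.lookup m p = 0}"
    unfolding subring_set_def
  proof (intro conjI ballI CollectI)
    fix r s :: "(nat \<Rightarrow>\<^sub>0 nat) \<Rightarrow>\<^sub>0 'a" and m
    assume rs: "r \<in> {r. \<forall>m\<in>Poly_Mapping.keys r. Poly_Mapping.lookup m p = 0}"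
      "s \<in> {r. \<forall>m\<in>Poly_Mapping.keys r. Poly_Mapping.lookup m p = 0}"
    show "Poly_Mapping.lookup m p = 0" if "m \<in> Poly_Mapping.keys (r - s)"
      using rs that keys_diff[of r s] by auto
    show "Poly_Mapping.lookup m p = 0" if "m \<in> Poly_Mapping.keys (r * s)"
      using rs that keys_mult[of r s] by (force simp: lookup_add)
  qed auto
qed

lemma amb_const_free: "amb_const c \<in> amb_free p"
  unfolding amb_free_def amb_const_def by (rule imageI) simp

lemma amb_var_free: "j \<noteq> p \<Longrightarrow> amb_var j \<in> amb_free p"
  unfolding amb_free_def amb_var_def by (rule imageI) (simp add: mp_var_def lookup_single)

lemma amb_coeff_free: "amb (mp_coeff p r i) \<in> amb_free p"
  unfolding amb_free_def by (rule imageI) (auto dest: mp_coeff_free)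

text \<open>A relation pulls back to an identity between polynomials. As the coefficients
  \<open>a i\<close> are free of X_p, terms with different powers of X_p cannot cancel, so every
  \<open>a i\<close> is 0.\<close>

lemma amb_var_transcendental: "\<not> alg_over (amb_free p) (amb_var p)"
proof
  assume "alg_over (amb_free p) (amb_var p :: 'a ambient)"
  then obtain P :: "'a ambient poly" where P: "P \<noteq> 0" "\<And>i. coeff P i \<in> amb_free p" "poly P (amb_var p) = 0"
    unfolding alg_over_def by blast
  then have "\<exists>r. coeff P i = amb r \<and> (\<forall>m\<in>Poly_Mapping.keys r. Poly_Mapping.lookup m p = 0)" for i
    unfolding amb_free_def by blast
  then obtain a where a: "\<And>i. coeff P i = amb (a i)"
    "\<And>i m. m \<in> Poly_Mapping.keys (a i) \<Longrightarrow> Poly_Mapping.lookup m p = 0"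
    by metis
  have "amb (\<Sum>i\<le>degree P. a i * mp_var p ^ i) = poly P (amb_var p)"
    by (simp add: poly_altdef a(1) amb_var_def amb.sum amb.mult amb.power)
  then have sum0: "(\<Sum>i\<le>degree P. a i * mp_var p ^ i) = 0" using P(3) by simp
  have lk: "Poly_Mapping.lookup (a i * mp_var p ^ i) n =
      (if i = Poly_Mapping.lookup n p then Poly_Mapping.lookup (a i) (n - Poly_Mapping.single p i) else 0)" for i n
  proof -
    have "a i * mp_var p ^ i = (\<Sum>m\<in>Poly_Mapping.keys (a i).
        Poly_Mapping.single (m + Poly_Mapping.single p i) (Poly_Mapping.lookup (a i) m))"
      by (subst poly_mapping_sum_single[of "a i"]) (simp add: mp_var_power sum_distrib_right mult_single)
    then have *: "Poly_Mapping.lookup (a i * mp_var p ^ i) n = (\<Sum>m\<in>Poly_Mapping.keys (a i).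
        if m + Poly_Mapping.single p i = n then Poly_Mapping.lookup (a i) m else 0)"
      by (simp add: lookup_sum lookup_single when_def)
    show ?thesis
    proof (cases "i = Poly_Mapping.lookup n p")
      case True
      have e: "m + Poly_Mapping.single p i = n \<longleftrightarrow> m = n - Poly_Mapping.single p i" for m
        using minus_single_add[of n p] True by (metis add_diff_cancel_right')
      show ?thesis unfolding * by (simp add: e True[symmetric] in_keys_iff)
    next
      case False
      then have "m + Poly_Mapping.single p i \<noteq> n" if "m \<in> Poly_Mapping.keys (a i)" for m
        using a(2)[OF that] by (auto simp: lookup_add)
      then show ?thesis using False by (simp add: *)
    qed
  qed
  have "a i = 0" if "i \<le> degree P" for i
  proof (rule poly_mapping_eqI)
    fix m
    show "Poly_Mapping.lookup (a i) m = Poly_Mapping.lookup 0 m"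
    proof (cases "Poly_Mapping.lookup m p = 0")
      case True
      have "Poly_Mapping.lookup (\<Sum>j\<le>degree P. a j * mp_var p ^ j) (m + Poly_Mapping.single p i) = Poly_Mapping.lookup (a i) m"
        using that by (simp add: lookup_sum lk lookup_add True)
      then show ?thesis using sum0 by simp
    next
      case False
      then show ?thesis using a(2)[of m i] by (auto simp: in_keys_iff)
    qed
  qed
  then have "coeff P i = 0" if "i \<le> degree P" for i using that a(1) by simp
  then show False using P(1) by (metis leading_coeff_0_iff order_refl)
qed

definition amb_subst :: "nat \<Rightarrow> 'a::field ambient \<Rightarrow> ((nat \<Rightarrow>\<^sub>0 nat) \<Rightarrow>\<^sub>0 'a) \<Rightarrow> 'a ambient" where
  "amb_subst p b = mp_eval amb_const (amb_var(p := b))"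

lemma ring_map_amb_subst: "ring_map (amb_subst p b)"
  unfolding amb_subst_def by (rule amb_const.mp_eval_ring_map)

lemma amb_subst_const [simp]: "amb_subst p b (mp_const c) = amb_const c"
  and amb_subst_var: "amb_subst p b (mp_var j) = (if j = p then b else amb_var j)"
  by (simp_all add: amb_subst_def)

text \<open>A nonzero element of the kernel, read as a polynomial in X_p, is an algebraic equation
  for \<open>b\<close> over the polynomials in the other variables.\<close>

lemma inj_amb_subst:
  assumes "\<not> alg_over (amb_free p) b"
  shows "inj (amb_subst p b)"
proof (rule ring_map.inj_onI_kernel[OF ring_map_amb_subst], rule ccontr)
  fix r assume r: "amb_subst p b r = 0" "r \<noteq> 0"
  let ?s = "mp_section amb_const amb_var p r"
  have c: "coeff ?s i = amb (mp_coeff p r i)" for i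
    by (simp add: amb_const.coeff_mp_section mp_eval_amb)
  obtain m where "m \<in> Poly_Mapping.keys r" using r(2) by (metis poly_mapping_eqI in_keys_iff lookup_zero)
  then have "coeff ?s (Poly_Mapping.lookup m p) \<noteq> 0" by (simp add: c mp_coeff_neq_0)
  then have "?s \<noteq> 0" by auto
  moreover have "poly ?s b = 0" using r(1) by (simp add: amb_const.poly_mp_section amb_subst_def)
  ultimately show False using assms c amb_coeff_free unfolding alg_over_def by metis
qed

text \<open>Dividing out the power of the variable leaves a polynomial with nonzero constant term;
  it is nonconstant, since otherwise \<open>p\<close> would have only one term.\<close>

lemma exists_nonzero_root:
  fixes p :: "'a::alg_closed_field poly"
  assumes "coeff p i \<noteq> 0" "coeff p j \<noteq> 0" "i \<noteq> j"
  shows "\<exists>x. x \<noteq> 0 \<and> poly p x = 0"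
proof -
  have "p \<noteq> 0" using assms by auto
  from order_decomp[OF this, of 0] obtain q where q: "p = [:0, 1:] ^ order 0 p * q" "\<not> [:0, 1:] dvd q"
    by auto
  have "poly q 0 \<noteq> 0" using q(2) by (auto simp: poly_eq_0_iff_dvd)
  have "degree q > 0"
  proof (rule ccontr)
    assume "\<not> degree q > 0"
    then obtain c where "q = [:c:]" by (auto elim: degree_eq_zeroE)
    then have "p = monom c (order 0 p)" using q(1) by (metis monom_altdef mult.commute mult_smult_left mult_1 one_pCons smult_one smult_pCons mult.right_neutral smult_0_right)
    then have "coeff p k \<noteq> 0 \<Longrightarrow> k = order 0 p" for k by (metis coeff_monom)
    then show False using assms by metis
  qed
  then obtain x where x: "poly q x = 0" using alg_closed_imp_poly_has_root[of q] by auto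
  with \<open>poly q 0 \<noteq> 0\<close> have "x \<noteq> 0" by auto
  moreover have "poly p x = 0" using x by (subst q(1)) simp
  ultimately show ?thesis by blast
qed

text \<open>The coordinates are moved into \<open>S\<close> one at a time: the univariate section is
  nonzero, so it has finitely many roots and \<open>S\<close> contains a non-root.\<close>

lemma mp_eval_nonzero_in_infinite_set:
  fixes h :: "'a::comm_ring_1 \<Rightarrow> 'b::idom"
  assumes h: "ring_map h" and S: "infinite S" and J: "finite J" and nz: "mp_eval h w r \<noteq> 0"
  shows "\<exists>w'. (\<forall>j. j \<notin> J \<longrightarrow> w' j = w j) \<and> (\<forall>j\<in>J. w' j \<in> S) \<and> mp_eval h w' r \<noteq> 0"
  using J
proof (induction J)
  case empty
  then show ?case using nz by blast
next
  case (insert j J)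
  then obtain w' where w': "\<forall>j. j \<notin> J \<longrightarrow> w' j = w j" "\<forall>j\<in>J. w' j \<in> S" "mp_eval h w' r \<noteq> 0" by blast
  let ?s = "mp_section h w' j r"
  have e: "poly ?s x = mp_eval h (w'(j := x)) r" for x by (rule ring_map.poly_mp_section[OF h])
  have "?s \<noteq> 0" using w'(3) e[of "w' j"] by auto
  then have "finite {x. poly ?s x = 0}" by (rule poly_roots_finite)
  then obtain x where "x \<in> S" "poly ?s x \<noteq> 0" using S by (metis (mono_tags, lifting) finite_subset mem_Collect_eq subsetI)
  then show ?case using w' insert.hyps by (intro exI[of _ "w'(j := x)"]) (auto simp: e fun_upd_def)
qed


section \<open>Solving one equation in one difference variable\<close>

lemma mp_eval_comp_mp_eval:
  assumes "ring_map h"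
  shows "mp_eval h w (mp_eval (\<lambda>c. mp_const (g c)) (\<lambda>v. mp_var (\<pi> v)) r) = mp_eval (\<lambda>c. h (g c)) (\<lambda>v. w (\<pi> v)) r"
  using ring_map.mp_eval_comp[OF ring_map.mp_eval_ring_map[OF assms], of w "\<lambda>c. mp_const (g c)" "\<lambda>v. mp_var (\<pi> v)" r]
  by (simp add: o_def ring_map.mp_eval_var[OF assms] ring_map.mp_eval_const[OF assms])

lemma ring_map_inv: "ring_map h \<Longrightarrow> bij h \<Longrightarrow> ring_map (inv_into UNIV h)"
  by (unfold_locales; rule inv_f_eq) (simp_all add: ring_map_def bij_is_inj bij_is_surj surj_f_inv_f)

text \<open>The embedding \<open>\<gamma>\<close> precomposed with the automorphism acting as \<open>\<sigma>\<close> on constants and as \<open>\<pi>\<close> on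
  variables has the same range as \<open>\<gamma>\<close>, so it lifts to the ambient field.\<close>

lemma lift_to_ambient:
  fixes \<sigma> :: "'a::field \<Rightarrow> 'a" and \<gamma> :: "((nat \<Rightarrow>\<^sub>0 nat) \<Rightarrow>\<^sub>0 'a) \<Rightarrow> 'a ambient"
  assumes \<sigma>: "ring_map \<sigma>" "bij \<sigma>" and \<pi>: "bij \<pi>"
    and \<gamma>: "ring_map \<gamma>" "inj \<gamma>" "\<And>c. \<gamma> (mp_const c) = amb_const c"
    and alg: "\<And>x. alg_over (range \<gamma>) x"
  shows "\<exists>\<tau>. ring_map \<tau> \<and> bij \<tau> \<and> (\<forall>c. \<tau> (amb_const c) = amb_const (\<sigma> c)) \<and>
    (\<forall>j. \<tau> (amb_var j) = \<gamma> (mp_var (\<pi> j)))"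
proof -
  define act where "act \<sigma> \<pi> = mp_eval (\<lambda>c. mp_const (\<sigma> c)) (\<lambda>v. mp_var (\<pi> v))"
    for \<sigma> :: "'a \<Rightarrow> 'a" and \<pi> :: "nat \<Rightarrow> nat"
  have act_map: "ring_map (act \<sigma> \<pi>)" if "ring_map \<sigma>" for \<sigma> \<pi>
    unfolding act_def using ring_map_comp[OF ring_map_const that]
    by (intro ring_map.mp_eval_ring_map) (simp add: o_def)
  have act_act: "act \<sigma> \<pi> (act \<sigma>' \<pi>' r) = r" if "ring_map \<sigma>" "\<And>c. \<sigma> (\<sigma>' c) = c" "\<And>j. \<pi> (\<pi>' j) = j" for \<sigma> \<sigma>' \<pi> \<pi>' r
  proof -
    have "ring_map (\<lambda>c. mp_const (\<sigma> c))" using ring_map_comp[OF ring_map_const that(1)] by (simp add: o_def)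
    from mp_eval_comp_mp_eval[OF this, of "\<lambda>v. mp_var (\<pi> v)" \<sigma>' \<pi>' r] show ?thesis
      by (simp add: act_def that(2,3) mp_eval_ident)
  qed
  have "bij (act \<sigma> \<pi>)"
    by (rule o_bij[of "act (inv_into UNIV \<sigma>) (inv_into UNIV \<pi>)"])
      (auto simp: fun_eq_iff \<sigma> \<pi> bij_is_inj bij_is_surj surj_f_inv_f intro!: act_act ring_map_inv)
  define \<beta> where "\<beta> = \<gamma> \<circ> act \<sigma> \<pi>"
  have "ring_map \<beta>" unfolding \<beta>_def by (intro ring_map_comp \<gamma> act_map \<sigma>)
  moreover have "inj \<beta>" unfolding \<beta>_def
    using \<gamma>(2) \<open>bij (act \<sigma> \<pi>)\<close> by (intro inj_compose) (auto simp: bij_is_inj)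
  moreover have "range \<beta> = range \<gamma>" unfolding \<beta>_def
    using \<open>bij (act \<sigma> \<pi>)\<close> by (metis bij_is_surj image_comp)
  ultimately obtain \<tau> where \<tau>: "ring_map \<tau>" "bij \<tau>" "\<And>r. \<tau> (amb r) = \<beta> r"
    using extend_to_automorphism[OF ring_map_amb inj_amb, of \<beta>] alg_over_range_amb alg by metis
  interpret const: ring_map "\<lambda>c. mp_const (\<sigma> c) :: (nat \<Rightarrow>\<^sub>0 nat) \<Rightarrow>\<^sub>0 'a"
    using ring_map_comp[OF ring_map_const \<sigma>(1)] by (simp add: o_def)
  have "\<tau> (amb_const c) = amb_const (\<sigma> c)" for c
    unfolding amb_const_def \<tau>(3) \<beta>_def o_def act_def const.mp_eval_const \<gamma>(3) ..
  moreover have "\<tau> (amb_var j) = \<gamma> (mp_var (\<pi> j))" for j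
    unfolding amb_var_def \<tau>(3) \<beta>_def o_def act_def const.mp_eval_var ..
  ultimately show ?thesis using \<tau> by blast
qed

text \<open>The cycle p, p + 1, ..., d - 1 and back to p; for p = d - 1 it is the identity.\<close>

lemma bij_cycle:
  fixes p d :: nat
  assumes "p < d"
  shows "bij (\<lambda>j. if p \<le> j \<and> Suc j < d then Suc j else if Suc j = d then p else j)"
  by (rule o_bij[of "\<lambda>j. if j = p then d - 1 else if p < j \<and> j < d then j - 1 else j"])
    (use assms in \<open>auto simp: fun_eq_iff\<close>)

lemma funpow_inv_cancel: "bij \<tau> \<Longrightarrow> (\<tau> ^^ n) ((inv_into UNIV \<tau> ^^ n) x) = x"
  for \<tau> :: "'a \<Rightarrow> 'a"
proof (induction n)
  case (Suc n)
  have "(\<tau> ^^ Suc n) ((inv_into UNIV \<tau> ^^ Suc n) x) =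
      (\<tau> ^^ n) (\<tau> (inv_into UNIV \<tau> ((inv_into UNIV \<tau> ^^ n) x)))"
    by (simp add: funpow_swap1[of \<tau>])
  then show ?case using Suc by (simp add: bij_is_surj surj_f_inv_f)
qed simp

theorem exists_lift_with_root:
  fixes \<sigma> :: "'a::field \<Rightarrow> 'a" and G :: "(nat \<Rightarrow>\<^sub>0 nat) \<Rightarrow>\<^sub>0 'a"
  assumes \<sigma>: "ring_map \<sigma>" "bij \<sigma>"
    and keys: "m1 \<in> Poly_Mapping.keys G" "m2 \<in> Poly_Mapping.keys G"
      "Poly_Mapping.lookup m1 d \<noteq> Poly_Mapping.lookup m2 d"
    and le_d: "\<And>m v. m \<in> Poly_Mapping.keys G \<Longrightarrow> v \<in> Poly_Mapping.keys m \<Longrightarrow> v \<le> d"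
  shows "\<exists>\<tau> t. ring_map \<tau> \<and> bij \<tau> \<and> (\<forall>c. \<tau> (amb_const c) = amb_const (\<sigma> c)) \<and> t \<noteq> 0 \<and>
    mp_eval amb_const (\<lambda>j. (\<tau> ^^ j) t) G = 0"
proof -
  define ev where "ev w = mp_eval amb_const w G" for w :: "nat \<Rightarrow> 'a ambient"
  have ev_cong: "ev w = ev w'" if "\<And>j. j \<le> d \<Longrightarrow> w j = w' j" for w w'
    unfolding ev_def using that le_d by (intro mp_eval_cong) blast
  \<comment> \<open>At the generic point no nonzero coefficient polynomial vanishes, so
    \<open>m1\<close> and \<open>m2\<close> give two nonzero coefficients in different
    degrees.\<close>
  have "coeff (mp_section amb_const amb_var d G) (Poly_Mapping.lookup m d) \<noteq> 0" if "m \<in> Poly_Mapping.keys G" for m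
    using that by (simp add: amb_const.coeff_mp_section mp_eval_amb mp_coeff_neq_0)
  then obtain b where b: "b \<noteq> 0" "ev (amb_var(d := b)) = 0"
    using exists_nonzero_root[of "mp_section amb_const amb_var d G"] keys
    unfolding amb_const.poly_mp_section ev_def by blast
  \<comment> \<open>\<open>V q\<close>: the first \<open>q\<close> variables are irrelevant for \<open>b\<close> being a root.\<close>
  define V where "V q \<longleftrightarrow> (\<forall>y. ev (\<lambda>j. if j < q then y j else if j = d then b else amb_var j) = 0)" for q
  define p where "p = (GREATEST q. q \<le> d \<and> V q)"
  have "V 0" unfolding V_def using b(2) by (simp add: fun_upd_def)
  then have p: "p \<le> d" "V p"
    using GreatestI_nat[of "\<lambda>q. q \<le> d \<and> V q" 0 d] unfolding p_def by auto
  have pmax: "q \<le> p" if "q \<le> d" "V q" for q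
    unfolding p_def using that by (intro Greatest_le_nat[of _ _ d]) auto
  show ?thesis
  proof (cases "p = d")
    case True
    obtain \<tau> where \<tau>: "ring_map \<tau>" "bij \<tau>" "\<And>c. \<tau> (amb_const c) = amb_const (\<sigma> c)"
      using lift_to_ambient[OF \<sigma> bij_id ring_map_amb inj_amb _ alg_over_range_amb] by (auto simp: amb_const_def)
    define t where "t = (inv_into UNIV \<tau> ^^ d) b"
    have td: "(\<tau> ^^ d) t = b" unfolding t_def by (rule funpow_inv_cancel[OF \<tau>(2)])
    have "(\<tau> ^^ n) 0 = 0" for n by (induction n) (simp_all add: ring_map.zero[OF \<tau>(1)])
    then have "t \<noteq> 0" using td b(1) by metis
    moreover have "ev (\<lambda>j. (\<tau> ^^ j) t) = 0"
    proof -
      have "ev (\<lambda>j. (\<tau> ^^ j) t) = ev (\<lambda>j. if j < d then (\<tau> ^^ j) t else if j = d then b else amb_var j)"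
        by (rule ev_cong) (auto simp: td)
      also have "\<dots> = 0" using p(2)[unfolded True V_def] by (rule spec)
      finally show ?thesis .
    qed
    ultimately show ?thesis using \<tau> unfolding ev_def by blast
  next
    case False
    then have pd: "p < d" using p by simp
    have "\<not> V (Suc p)" using pmax[of "Suc p"] pd by auto
    then obtain y where y: "ev (\<lambda>j. if j < Suc p then y j else if j = d then b else amb_var j) \<noteq> 0"
      unfolding V_def by blast
    \<comment> \<open>Indices above \<open>d\<close> keep the new values distinct from X_p, so they
      will lie in every ring that contains the variables other than X_p.\<close>
    have "infinite (amb_var ` {Suc d..} :: 'a ambient set)"
      using inj_amb_var by (subst finite_image_iff) (auto intro: inj_on_subset simp: infinite_Ici)
    from mp_eval_nonzero_in_infinite_set[OF amb_const.ring_map_axioms this finite_lessThan y[unfolded ev_def]]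
    obtain w where w: "\<And>j. j \<notin> {..<Suc p} \<Longrightarrow> w j = (if j < Suc p then y j else if j = d then b else amb_var j)"
      "\<And>j. j \<in> {..<Suc p} \<Longrightarrow> w j \<in> amb_var ` {Suc d..}" "ev w \<noteq> 0"
      unfolding ev_def by metis
    \<comment> \<open>With X_p back in place only the first \<open>p\<close> arguments differ from
      those at which \<open>b\<close> is a root, and by \<open>V p\<close> these may be
      arbitrary.\<close>
    have "ev (w(p := amb_var p)) = ev (\<lambda>j. if j < p then w j else if j = d then b else amb_var j)"
      by (rule ev_cong) (use w(1) pd in auto)
    also have "\<dots> = 0" using p(2) unfolding V_def by blast
    finally have w0: "ev (w(p := amb_var p)) = 0" .
    \<comment> \<open>The section of \<open>G\<close> at \<open>w\<close> in direction
      \<open>p\<close> is nonzero at \<open>w p\<close> but vanishes at X_p, and its coefficients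
      only involve constants, other variables and \<open>b\<close>. This is used for two different
      rings \<open>B\<close>.\<close>
    have alg_p: "alg_over B (amb_var p)"
      if B: "subring_set B" "\<And>c. amb_const c \<in> B" "\<And>j. j \<noteq> p \<Longrightarrow> amb_var j \<in> B" "b \<in> B" for B
      unfolding alg_over_def
    proof (intro exI conjI allI)
      let ?s = "mp_section amb_const w p G"
      have "poly ?s (w p) \<noteq> 0" using w(3) by (simp add: amb_const.poly_mp_section ev_def)
      then show "?s \<noteq> 0" by auto
      show "poly ?s (amb_var p) = 0" using w0 by (simp add: amb_const.poly_mp_section ev_def)
      fix i
      have "w j \<in> B" if "j \<noteq> p" for j
      proof (cases "j < p")
        case True
        then obtain j' where "w j = amb_var j'" "j' \<ge> Suc d" using w(2)[of j] by auto
        then show ?thesis using B(3)[of j'] pd by auto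
      next
        case False
        then have "w j = (if j = d then b else amb_var j)" using w(1)[of j] that by auto
        then show ?thesis using B that by auto
      qed
      then show "coeff ?s i \<in> B"
        unfolding amb_const.coeff_mp_section
        by (intro mp_eval_in_subring_set[OF B(1)] B(2)) (auto dest: keys_mp_coeff_subset)
    qed
    \<comment> \<open>If \<open>b\<close> were algebraic over the polynomials in the other
      variables, then X_p would be too, by \<open>alg_p\<close> and transitivity.\<close>
    have trans: "\<not> alg_over (amb_free p) b"
    proof
      assume alg_b: "alg_over (amb_free p) b"
      have "alg_over {x. alg_over (amb_free p) x} (amb_var p :: 'a ambient)"
        by (rule alg_p[OF subring_set_alg_over[OF subring_set_amb_free]])
          (auto intro: alg_b alg_over_self[OF subring_set_amb_free] amb_const_free amb_var_free)
      then have "alg_over (amb_free p) (amb_var p :: 'a ambient)"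
        by (rule alg_over_trans[OF subring_set_amb_free order_refl])
      then show False using amb_var_transcendental by blast
    qed
    define R where "R = range (amb_subst p b)"
    have R: "subring_set R"
      unfolding R_def by (rule ring_map.subring_set_image[OF ring_map_amb_subst subring_set_UNIV])
    have Rc: "amb_const c \<in> R" for c unfolding R_def by (rule range_eqI[of _ _ "mp_const c"]) simp
    have Rv: "amb_var j \<in> R" if "j \<noteq> p" for j
      unfolding R_def by (rule range_eqI[of _ _ "mp_var j"]) (simp add: amb_subst_var that)
    have Rb: "b \<in> R" unfolding R_def by (rule range_eqI[of _ _ "mp_var p"]) (simp add: amb_subst_var)
    \<comment> \<open>Together with \<open>trans\<close> this says that \<open>b\<close> and the X_j
      with j different from \<open>p\<close> form a transcendence basis.\<close>
    have algR: "alg_over R (amb_var j)" for j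
      by (cases "j = p") (auto intro: alg_p R Rc Rv Rb alg_over_self)
    have "amb r \<in> {x. alg_over R x}" for r
      unfolding mp_eval_amb[symmetric]
      by (intro mp_eval_in_subring_set[OF subring_set_alg_over[OF R]]) (auto intro: algR alg_over_self R Rc)
    then have alg: "alg_over R x" for x
      by (intro alg_over_trans[OF R _ alg_over_range_amb]) auto
    \<comment> \<open>Since \<open>amb_subst\<close> turns X_p into \<open>b\<close>, closing the
      cycle at \<open>p\<close> makes \<tau> send X_{d-1} to \<open>b\<close>.\<close>
    let ?\<pi> = "\<lambda>j. if p \<le> j \<and> Suc j < d then Suc j else if Suc j = d then p else j"
    obtain \<tau> where \<tau>: "ring_map \<tau>" "bij \<tau>" "\<And>c. \<tau> (amb_const c) = amb_const (\<sigma> c)"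
      "\<And>j. \<tau> (amb_var j) = amb_subst p b (mp_var (?\<pi> j))"
      using lift_to_ambient[OF \<sigma> bij_cycle[OF pd] ring_map_amb_subst inj_amb_subst[OF trans] amb_subst_const alg[unfolded R_def]]
      by blast
    define t where "t = (inv_into UNIV \<tau> ^^ d) b"
    have td: "(\<tau> ^^ d) t = b" unfolding t_def by (rule funpow_inv_cancel[OF \<tau>(2)])
    have "(\<tau> ^^ n) 0 = 0" for n by (induction n) (simp_all add: ring_map.zero[OF \<tau>(1)])
    then have "t \<noteq> 0" using td b(1) by metis
    have step: "(\<tau> ^^ Suc i) (amb_var j) = b" if "Suc i + j = d" "p \<le> j" for i j
      using that
    proof (induction i arbitrary: j)
      case 0
      then show ?case by (simp add: \<tau>(4) amb_subst_var)
    next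
      case (Suc i)
      then have "\<tau> (amb_var j) = amb_var (Suc j)" by (simp add: \<tau>(4) amb_subst_var)
      then show ?case using Suc.IH[of "Suc j"] Suc.prems by (simp add: funpow_swap1)
    qed
    \<comment> \<open>Both sides are carried to \<open>b\<close> by the injective power of \<tau>
      with exponent d - j, written \<open>Suc i\<close>.\<close>
    have tj: "(\<tau> ^^ j) t = amb_var j" if pj: "p \<le> j" and jd: "j < d" for j
    proof -
      obtain i where i: "Suc i + j = d" using jd less_iff_Suc_add by auto
      then have "(\<tau> ^^ Suc i) ((\<tau> ^^ j) t) = (\<tau> ^^ Suc i) (amb_var j)"
        using td step[OF i pj] by (metis comp_apply funpow_add)
      moreover have "inj (\<tau> ^^ Suc i)" using \<tau>(2) by (intro inj_fn bij_is_inj)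
      ultimately show ?thesis by (meson injD)
    qed
    \<comment> \<open>Nothing is known about the conjugates with j < p; \<open>V p\<close> absorbs
      them.\<close>
    have "ev (\<lambda>j. (\<tau> ^^ j) t) = ev (\<lambda>j. if j < p then (\<tau> ^^ j) t else if j = d then b else amb_var j)"
      by (rule ev_cong) (auto simp: td tj)
    also have "\<dots> = 0" using p(2)[unfolded V_def] by (rule spec)
    finally show ?thesis using \<tau> \<open>t \<noteq> 0\<close> unfolding ev_def by blast
  qed
qed


section \<open>Reduction to one equation in one difference variable\<close>

text \<open>Renames exponent vectors, possibly into another set of variables. Terms with the same
  new name would be added, hence the injectivity hypotheses below.\<close>

definition mp_rekey :: "('k \<Rightarrow> 'l) \<Rightarrow> ('k \<Rightarrow>\<^sub>0 'a::comm_monoid_add) \<Rightarrow> 'l \<Rightarrow>\<^sub>0 'a" where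
  "mp_rekey h r = (\<Sum>m\<in>Poly_Mapping.keys r. Poly_Mapping.single (h m) (Poly_Mapping.lookup r m))"

lemma
  assumes "inj_on h (Poly_Mapping.keys r)"
  shows lookup_mp_rekey: "m \<in> Poly_Mapping.keys r \<Longrightarrow> Poly_Mapping.lookup (mp_rekey h r) (h m) = Poly_Mapping.lookup r m"
    and keys_mp_rekey: "Poly_Mapping.keys (mp_rekey h r) = h ` Poly_Mapping.keys r"
proof -
  show l: "Poly_Mapping.lookup (mp_rekey h r) (h m) = Poly_Mapping.lookup r m" if "m \<in> Poly_Mapping.keys r" for m
  proof -
    have "Poly_Mapping.lookup (mp_rekey h r) (h m) =
        (\<Sum>n\<in>Poly_Mapping.keys r. if n = m then Poly_Mapping.lookup r n else 0)"
      unfolding mp_rekey_def lookup_sum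
      by (intro sum.cong) (use that assms in \<open>auto simp: lookup_single when_def dest: inj_onD\<close>)
    then show ?thesis using that by simp
  qed
  have "Poly_Mapping.keys (mp_rekey h r) \<subseteq> h ` Poly_Mapping.keys r"
    unfolding mp_rekey_def using keys_sum[of "\<lambda>m. Poly_Mapping.single (h m) (Poly_Mapping.lookup r m)" "Poly_Mapping.keys r"]
    by (force split: if_splits)
  then show "Poly_Mapping.keys (mp_rekey h r) = h ` Poly_Mapping.keys r"
    using l by (auto simp: in_keys_iff)
qed

lemma mp_eval_mp_rekey:
  assumes "inj_on h (Poly_Mapping.keys r)"
  shows "mp_eval \<phi> w (mp_rekey h r) = (\<Sum>m\<in>Poly_Mapping.keys r. \<phi> (Poly_Mapping.lookup r m) * mp_monom w (h m))"
  unfolding mp_eval_def keys_mp_rekey[OF assms] sum.reindex[OF assms]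
  by (intro sum.cong) (simp_all add: lookup_mp_rekey[OF assms])

lemma lookup_sum_single:
  assumes "finite V" "inj_on e V"
  shows "v \<in> V \<Longrightarrow> Poly_Mapping.lookup (\<Sum>v\<in>V. Poly_Mapping.single (e v) (g v)) (e v) = g v"
    and "u \<notin> e ` V \<Longrightarrow> Poly_Mapping.lookup (\<Sum>v\<in>V. Poly_Mapping.single (e v) (g v)) u = 0"
proof -
  assume v: "v \<in> V"
  have "Poly_Mapping.lookup (\<Sum>v\<in>V. Poly_Mapping.single (e v) (g v)) (e v) = (\<Sum>u\<in>V. if u = v then g u else 0)"
    unfolding lookup_sum by (intro sum.cong) (use v assms in \<open>auto simp: lookup_single when_def dest: inj_onD\<close>)
  then show "Poly_Mapping.lookup (\<Sum>v\<in>V. Poly_Mapping.single (e v) (g v)) (e v) = g v"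
    using v assms by simp
qed (auto simp: lookup_sum lookup_single when_def intro!: sum.neutral)

lemma mp_monom_sum: "mp_monom w (\<Sum>i\<in>I. g i) = (\<Prod>i\<in>I. mp_monom w (g i))"
  by (induction I rule: infinite_finite_induct) (simp_all add: mp_monom_add)

definition mp_vars :: "(('v \<Rightarrow>\<^sub>0 'e::zero) \<Rightarrow>\<^sub>0 'a::zero) \<Rightarrow> 'v set" where
  "mp_vars r = (\<Union>m\<in>Poly_Mapping.keys r. Poly_Mapping.keys m)"

lemma finite_mp_vars [simp]: "finite (mp_vars r)"
  by (simp add: mp_vars_def)

lemma lookup_eq_0_outside_mp_vars: "m \<in> Poly_Mapping.keys r \<Longrightarrow> v \<notin> mp_vars r \<Longrightarrow> Poly_Mapping.lookup m v = 0"
  by (auto simp: mp_vars_def in_keys_iff)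

text \<open>Variables beyond the last one at which two exponent vectors differ contribute a common factor;
  the others are numbered by \<open>e (i, j) = N i + j\<close>, which turns a solution \<open>t\<close> of a one-variable
  equation into the solution \<open>x\<^sub>i = \<tau>\<^sup>N\<^sup>i t\<close>.\<close>

lemma exists_lift_with_solution:
  fixes \<sigma> :: "'a::field \<Rightarrow> 'a" and P :: "'a diff_poly"
  assumes \<sigma>: "ring_map \<sigma>" "bij \<sigma>"
    and m: "m1 \<in> Poly_Mapping.keys P" "m2 \<in> Poly_Mapping.keys P" "m1 \<noteq> m2"
  shows "\<exists>\<tau> z. ring_map \<tau> \<and> bij \<tau> \<and> (\<forall>c. \<tau> (amb_const c) = amb_const (\<sigma> c)) \<and> (\<forall>i. z i \<noteq> 0) \<and>
    mp_eval amb_const (\<lambda>v. (\<tau> ^^ snd v) (z (fst v))) P = 0"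
proof -
  define V where "V = mp_vars P"
  have V: "finite V" "\<And>m v. m \<in> Poly_Mapping.keys P \<Longrightarrow> v \<notin> V \<Longrightarrow> Poly_Mapping.lookup m v = 0"
    by (simp_all add: V_def lookup_eq_0_outside_mp_vars)
  \<comment> \<open>\<open>N\<close> exceeds every order of \<sigma> that occurs, so
    \<open>e\<close> is inverted by division with remainder; \<open>insert 0\<close> covers an empty
    \<open>V\<close>.\<close>
  define N where "N = Suc (Max (insert 0 (snd ` V)))"
  have N: "snd v < N" if "v \<in> V" for v
    unfolding N_def using that V(1) by (simp add: less_Suc_eq_le)
  define e where "e v = fst v * N + snd v" for v :: "nat \<times> nat"
  have inj: "inj_on e V"
  proof (rule inj_onI)
    fix u v assume "u \<in> V" "v \<in> V" and eq: "e u = e v"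
    moreover have "e v div N = fst v \<and> e v mod N = snd v" if "v \<in> V" for v
      using N[OF that] by (simp add: e_def)
    ultimately show "u = v" by (metis prod_eqI)
  qed
  define Df where "Df = {v\<in>V. \<exists>m\<in>Poly_Mapping.keys P. \<exists>m'\<in>Poly_Mapping.keys P. Poly_Mapping.lookup m v \<noteq> Poly_Mapping.lookup m' v}"
  obtain v where "Poly_Mapping.lookup m1 v \<noteq> Poly_Mapping.lookup m2 v"
    using m(3) poly_mapping_eqI[of m1 m2] by blast
  moreover from this have "v \<in> V" using V(2)[of m1 v] V(2)[of m2 v] m by (cases "v \<in> V") auto
  ultimately have "v \<in> Df" using m(1,2) unfolding Df_def by blast
  \<comment> \<open>\<open>D\<close> becomes the top variable of the one-variable equation: two
    exponent vectors differ there, and none differ beyond it.\<close>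
  define D where "D = Max (e ` Df)"
  have finD: "finite (e ` Df)" using V(1) by (simp add: Df_def)
  have "D \<in> e ` Df" unfolding D_def using \<open>v \<in> Df\<close> finD by (intro Max_in) auto
  then obtain v0 k1 k2 where v0: "v0 \<in> V" "e v0 = D" "k1 \<in> Poly_Mapping.keys P" "k2 \<in> Poly_Mapping.keys P"
    "Poly_Mapping.lookup k1 v0 \<noteq> Poly_Mapping.lookup k2 v0" by (auto simp: Df_def)
  have same: "Poly_Mapping.lookup m v = Poly_Mapping.lookup m1 v"
    if "m \<in> Poly_Mapping.keys P" "v \<in> V" "\<not> e v \<le> D" for m v
  proof (rule ccontr)
    assume "Poly_Mapping.lookup m v \<noteq> Poly_Mapping.lookup m1 v"
    then have "v \<in> Df" using that m by (auto simp: Df_def)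
    then have "e v \<le> D" unfolding D_def using finD by (intro Max_ge) auto
    then show False using that by simp
  qed
  define W where "W = {v\<in>V. e v \<le> D}"
  have W: "finite W" "inj_on e W" using V(1) inj by (auto simp: W_def intro: inj_on_subset)
  define flat where "flat m = (\<Sum>v\<in>W. Poly_Mapping.single (e v) (Poly_Mapping.lookup m v))" for m :: "nat \<times> nat \<Rightarrow>\<^sub>0 nat"
  have fl: "Poly_Mapping.lookup (flat m) (e v) = Poly_Mapping.lookup m v" if "v \<in> W" for m v
    unfolding flat_def by (rule lookup_sum_single(1)[OF W that])
  have fl_out: "Poly_Mapping.lookup (flat m) u = 0" if "u \<notin> e ` W" for m u
    unfolding flat_def by (rule lookup_sum_single(2)[OF W that])
  \<comment> \<open>Dropping the variables numbered above \<open>D\<close> merges no terms, because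
    all exponent vectors agree on them.\<close>
  have inj_flat: "inj_on flat (Poly_Mapping.keys P)"
  proof (rule inj_onI, rule poly_mapping_eqI)
    fix m m' v assume mm: "m \<in> Poly_Mapping.keys P" "m' \<in> Poly_Mapping.keys P" "flat m = flat m'"
    consider "v \<notin> V" | "v \<in> W" | "v \<in> V" "\<not> e v \<le> D" by (auto simp: W_def)
    then show "Poly_Mapping.lookup m v = Poly_Mapping.lookup m' v"
    proof cases
      case 1
      then show ?thesis using mm V(2) by simp
    next
      case 2
      then show ?thesis using fl[of v] mm(3) by metis
    next
      case 3
      then show ?thesis using same mm by simp
    qed
  qed
  define G where "G = mp_rekey flat P"
  have G_keys: "Poly_Mapping.keys G = flat ` Poly_Mapping.keys P"
    unfolding G_def by (rule keys_mp_rekey[OF inj_flat])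
  have "v0 \<in> W" using v0 by (simp add: W_def)
  have "Poly_Mapping.lookup (flat k1) D \<noteq> Poly_Mapping.lookup (flat k2) D"
    using fl[OF \<open>v0 \<in> W\<close>] v0 by simp
  moreover have "u \<le> D" if "m \<in> Poly_Mapping.keys G" "u \<in> Poly_Mapping.keys m" for m u
    using that fl_out[of u] by (cases "u \<in> e ` W") (auto simp: G_keys in_keys_iff W_def)
  ultimately obtain \<tau> t where \<tau>: "ring_map \<tau>" "bij \<tau>" "\<And>c. \<tau> (amb_const c) = amb_const (\<sigma> c)" "t \<noteq> 0"
    and root: "mp_eval amb_const (\<lambda>j. (\<tau> ^^ j) t) G = 0"
    using exists_lift_with_root[OF \<sigma>, of "flat k1" G "flat k2" D] v0(3,4) by (auto simp: G_keys)
  have nz: "(\<tau> ^^ n) t \<noteq> 0" for n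
  proof (induction n)
    case (Suc n)
    then show ?case using \<tau>(1,2) by (metis bij_is_inj comp_apply funpow.simps(2) injD ring_map.zero)
  qed (use \<tau> in simp)
  define z where "z i = (\<tau> ^^ (i * N)) t" for i
  let ?w = "\<lambda>v. (\<tau> ^^ e v) t"
  have ez: "(\<lambda>v. (\<tau> ^^ snd v) (z (fst v))) = ?w"
    by (simp add: z_def e_def fun_eq_iff add.commute funpow_add)
  \<comment> \<open>The common factor from the dropped variables; \<open>m1\<close> may stand for
    any exponent vector here.\<close>
  define U where "U = (\<Prod>v\<in>V - W. ?w v ^ Poly_Mapping.lookup m1 v)"
  have "mp_monom ?w m = U * mp_monom (\<lambda>j. (\<tau> ^^ j) t) (flat m)" if "m \<in> Poly_Mapping.keys P" for m
  proof -
    have "mp_monom ?w m = (\<Prod>v\<in>V. ?w v ^ Poly_Mapping.lookup m v)"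
      using that V by (intro mp_monom_superset) (auto simp: in_keys_iff)
    also have "\<dots> = (\<Prod>v\<in>V - W. ?w v ^ Poly_Mapping.lookup m v) * (\<Prod>v\<in>W. ?w v ^ Poly_Mapping.lookup m v)"
      using V(1) by (intro prod.subset_diff) (auto simp: W_def)
    also have "(\<Prod>v\<in>V - W. ?w v ^ Poly_Mapping.lookup m v) = U"
      unfolding U_def using same[OF that] by (intro prod.cong) (auto simp: W_def)
    also have "(\<Prod>v\<in>W. ?w v ^ Poly_Mapping.lookup m v) = mp_monom (\<lambda>j. (\<tau> ^^ j) t) (flat m)"
      by (simp add: flat_def mp_monom_sum)
    finally show ?thesis .
  qed
  then have "mp_eval amb_const ?w P = U * mp_eval amb_const (\<lambda>j. (\<tau> ^^ j) t) G"
    unfolding G_def mp_eval_mp_rekey[OF inj_flat] unfolding mp_eval_def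
    by (simp add: sum_distrib_left mult.left_commute)
  then have "mp_eval amb_const (\<lambda>v. (\<tau> ^^ snd v) (z (fst v))) P = 0" by (simp add: ez root)
  moreover have "z i \<noteq> 0" for i unfolding z_def by (rule nz)
  ultimately show ?thesis using \<tau>(1-3) by blast
qed

text \<open>All terms are multiplied by the \<open>C\<close>-th power of the product of the
  variables. This shifts the exponent vectors injectively, so the number of terms is kept, and at
  points with nonzero coordinates the value changes by a nonzero factor.\<close>

lemma laurent_clear_denominators:
  fixes f :: "((nat \<times> nat) \<Rightarrow>\<^sub>0 int) \<Rightarrow>\<^sub>0 'a::field"
  shows "\<exists>P :: 'a diff_poly. card (Poly_Mapping.keys P) = card (Poly_Mapping.keys f) \<and> mp_vars P \<subseteq> mp_vars f \<and>
    (\<forall>w. (\<forall>v\<in>mp_vars f. w v \<noteq> 0) \<longrightarrow> mp_eval (\<lambda>c. c) w P = 0 \<longrightarrow>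
      (\<Sum>m\<in>Poly_Mapping.keys f. Poly_Mapping.lookup f m * (\<Prod>v\<in>Poly_Mapping.keys m. w v powi Poly_Mapping.lookup m v)) = 0)"
proof -
  define V where "V = mp_vars f"
  have V: "finite V" "\<And>m v. m \<in> Poly_Mapping.keys f \<Longrightarrow> v \<notin> V \<Longrightarrow> Poly_Mapping.lookup m v = 0"
    by (simp_all add: V_def lookup_eq_0_outside_mp_vars)
  \<comment> \<open>A bound for the absolute values of all exponents, so that every shifted exponent
    is nonnegative and \<open>nat\<close> is exact.\<close>
  define C where "C = Max (insert 0 ((\<lambda>(m, v). nat \<bar>Poly_Mapping.lookup m v\<bar>) ` (Poly_Mapping.keys f \<times> V)))"
  have C: "Poly_Mapping.lookup m v + int C \<ge> 0" if "m \<in> Poly_Mapping.keys f" "v \<in> V" for m v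
  proof -
    have "nat \<bar>Poly_Mapping.lookup m v\<bar> \<le> C"
      unfolding C_def using that V(1) by (intro Max_ge) auto
    then show ?thesis by linarith
  qed
  define shift where "shift m = (\<Sum>v\<in>V. Poly_Mapping.single v (nat (Poly_Mapping.lookup m v + int C)))"
    for m :: "nat \<times> nat \<Rightarrow>\<^sub>0 int"
  have sh: "Poly_Mapping.lookup (shift m) v = nat (Poly_Mapping.lookup m v + int C)" if "v \<in> V" for m v
    unfolding shift_def by (rule lookup_sum_single(1)[OF V(1) inj_on_id2 that])
  have sh_out: "Poly_Mapping.lookup (shift m) v = 0" if "v \<notin> V" for m v
    unfolding shift_def by (rule lookup_sum_single(2)[OF V(1) inj_on_id2]) (use that in simp)
  have inj: "inj_on shift (Poly_Mapping.keys f)"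
  proof (rule inj_onI, rule poly_mapping_eqI)
    fix m m' v assume mm: "m \<in> Poly_Mapping.keys f" "m' \<in> Poly_Mapping.keys f" "shift m = shift m'"
    show "Poly_Mapping.lookup m v = Poly_Mapping.lookup m' v"
    proof (cases "v \<in> V")
      case True
      then have "nat (Poly_Mapping.lookup m v + int C) = nat (Poly_Mapping.lookup m' v + int C)"
        using sh[OF True] mm(3) by metis
      then show ?thesis using C[OF mm(1) True] C[OF mm(2) True] by linarith
    qed (use mm V in simp)
  qed
  define P where "P = mp_rekey shift f"
  have keysP: "Poly_Mapping.keys P = shift ` Poly_Mapping.keys f"
    unfolding P_def by (rule keys_mp_rekey[OF inj])
  then have "card (Poly_Mapping.keys P) = card (Poly_Mapping.keys f)" by (simp add: card_image inj)
  moreover have "mp_vars P \<subseteq> mp_vars f"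
    unfolding V_def[symmetric] using sh_out by (auto simp: mp_vars_def keysP in_keys_iff)
  moreover have "(\<Sum>m\<in>Poly_Mapping.keys f. Poly_Mapping.lookup f m * (\<Prod>v\<in>Poly_Mapping.keys m. w v powi Poly_Mapping.lookup m v)) = 0"
    if w: "\<And>v. v \<in> V \<Longrightarrow> w v \<noteq> 0" and z: "mp_eval (\<lambda>c. c) w P = 0" for w
  proof -
    define U where "U = (\<Prod>v\<in>V. w v ^ C)"
    have "U \<noteq> 0" using w by (simp add: U_def V(1))
    have mon: "mp_monom w (shift m) = U * (\<Prod>v\<in>Poly_Mapping.keys m. w v powi Poly_Mapping.lookup m v)"
      if m: "m \<in> Poly_Mapping.keys f" for m
    proof -
      have "mp_monom w (shift m) = (\<Prod>v\<in>V. w v ^ nat (Poly_Mapping.lookup m v + int C))"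
        by (simp add: shift_def mp_monom_sum)
      also have "\<dots> = (\<Prod>v\<in>V. w v ^ C * w v powi Poly_Mapping.lookup m v)"
      proof (rule prod.cong)
        fix v assume "v \<in> V"
        then have "w v ^ nat (Poly_Mapping.lookup m v + int C) = w v powi (Poly_Mapping.lookup m v + int C)"
          using C[OF m] by (simp add: power_int_def)
        then show "w v ^ nat (Poly_Mapping.lookup m v + int C) = w v ^ C * w v powi Poly_Mapping.lookup m v"
          using w[OF \<open>v \<in> V\<close>] by (simp add: power_int_add mult.commute)
      qed simp
      also have "\<dots> = U * (\<Prod>v\<in>V. w v powi Poly_Mapping.lookup m v)"
        by (simp add: U_def prod.distrib)
      also have "(\<Prod>v\<in>V. w v powi Poly_Mapping.lookup m v) = (\<Prod>v\<in>Poly_Mapping.keys m. w v powi Poly_Mapping.lookup m v)"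
        using V m by (intro prod.mono_neutral_right) (auto simp: in_keys_iff)
      finally show ?thesis .
    qed
    have "mp_eval (\<lambda>c. c) w P = U * (\<Sum>m\<in>Poly_Mapping.keys f. Poly_Mapping.lookup f m *
        (\<Prod>v\<in>Poly_Mapping.keys m. w v powi Poly_Mapping.lookup m v))"
      unfolding P_def mp_eval_mp_rekey[OF inj] sum_distrib_left
      by (intro sum.cong) (simp_all add: mon mult.left_commute)
    then show ?thesis using z \<open>U \<noteq> 0\<close> by simp
  qed
  ultimately show ?thesis unfolding V_def by blast
qed

section \<open>Descent to the base field\<close>

lemma diff_eval_eq_mp_eval:
  "diff_eval ring_of_type_algebra \<tau> \<iota> p z = mp_eval \<iota> (\<lambda>v. (\<tau> ^^ snd v) (z (fst v))) p"
  for \<tau> :: "'b::field \<Rightarrow> 'b"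
  by (simp add: diff_eval_type mp_eval_def mp_monom_def)

lemma ring_iso_type_algebra: "\<tau> \<in> ring_iso ring_of_type_algebra ring_of_type_algebra \<longleftrightarrow> ring_map \<tau> \<and> bij \<tau>"
  by (auto simp: ring_iso_def ring_hom_def ring_map_def ring_of_type_algebra_def)

lemma difference_field_type_algebra:
  fixes \<tau> :: "'b::field \<Rightarrow> 'b"
  shows "difference_field ring_of_type_algebra \<tau> \<longleftrightarrow> ring_map \<tau> \<and> bij \<tau>"
  by (simp add: difference_field_def ring_iso_type_algebra field_from_type_algebra)

lemma keys_nontrivial:
  assumes "f \<noteq> 0" "\<not> laurent_monomial f"
  shows "card (Poly_Mapping.keys f) \<ge> 2"
proof (rule ccontr)
  assume "\<not> card (Poly_Mapping.keys f) \<ge> 2"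
  moreover have "card (Poly_Mapping.keys f) \<noteq> 0"
    using assms(1) by (auto simp: poly_mapping_eq_iff fun_eq_iff in_keys_iff)
  ultimately have "card (Poly_Mapping.keys f) = 1" by linarith
  then obtain m where m: "Poly_Mapping.keys f = {m}" by (auto simp: card_1_singleton_iff)
  then have "f = Poly_Mapping.single m (Poly_Mapping.lookup f m)"
    by (intro poly_mapping_eqI) (auto simp: lookup_single when_def in_keys_iff)
  moreover have "Poly_Mapping.lookup f m \<noteq> 0" using m by (auto simp: in_keys_iff)
  ultimately show False using assms(2) unfolding laurent_monomial_def by blast
qed

theorem theorem1p3:
  fixes \<sigma> :: "'a::field \<Rightarrow> 'a" and f :: "'a laurent_diff_poly" and n :: nat
  assumes "acfa \<sigma>"
    and "f \<in> laurent_diff_polys n"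
    and "\<not> laurent_monomial f"
  shows "\<exists>y. (\<forall>i\<in>{1..n}. y i \<noteq> 0) \<and> laurent_eval \<sigma> f y = 0"
proof (cases "f = 0")
  \<comment> \<open>Monomials have a nonzero coefficient, so the zero polynomial falls under the
    theorem.\<close>
  case True
  then show ?thesis by (intro exI[of _ "\<lambda>_. 1"]) (simp add: laurent_eval_def)
next
  case False
  have \<sigma>: "ring_map \<sigma>" "bij \<sigma>"
    using assms(1) by (auto simp: acfa_def difference_field_type_algebra)
  obtain P :: "'a diff_poly" where P: "card (Poly_Mapping.keys P) = card (Poly_Mapping.keys f)"
    "mp_vars P \<subseteq> mp_vars f" and clear: "\<forall>w. (\<forall>v\<in>mp_vars f. w v \<noteq> 0) \<longrightarrow> mp_eval (\<lambda>c. c) w P = 0 \<longrightarrow>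
      (\<Sum>m\<in>Poly_Mapping.keys f. Poly_Mapping.lookup f m * (\<Prod>v\<in>Poly_Mapping.keys m. w v powi Poly_Mapping.lookup m v)) = 0"
    using laurent_clear_denominators[of f] by blast
  have vars: "fst v \<in> {1..n}" if "v \<in> mp_vars f" for v
    using that assms(2) by (auto simp: mp_vars_def laurent_diff_polys_def)
  have "\<not> card (Poly_Mapping.keys P) \<le> Suc 0" using P(1) keys_nontrivial[OF False assms(3)] by simp
  then obtain m1 m2 where "m1 \<in> Poly_Mapping.keys P" "m2 \<in> Poly_Mapping.keys P" "m1 \<noteq> m2"
    unfolding card_le_Suc0_iff_eq[OF finite_keys] by blast
  from exists_lift_with_solution[OF \<sigma> this] obtain \<tau> z where
    \<tau>: "ring_map \<tau>" "bij \<tau>" "\<And>c. \<tau> (amb_const c) = amb_const (\<sigma> c)"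
    and z: "\<And>i. z i \<noteq> 0" "mp_eval amb_const (\<lambda>v. (\<tau> ^^ snd v) (z (fst v))) P = 0"
    by blast
  \<comment> \<open>The unknowns with indices \<open>n + 1, \<dots>, 2 n\<close> force the first \<open>n\<close> to be invertible.\<close>
  define Q :: "nat \<Rightarrow> 'a diff_poly" where "Q i = mp_var (i, 0) * mp_var (n + i, 0) - 1" for i
  define S where "S = insert P (Q ` {1..n})"
  have "finite S" by (simp add: S_def)
  have Q: "mp_eval h w (Q i) = w (i, 0) * w (n + i, 0) - 1" if "ring_map h" for h :: "'a \<Rightarrow> 'c::comm_ring_1" and w i
  proof -
    interpret h: ring_map h by fact
    interpret E: ring_map "mp_eval h w" by (rule h.mp_eval_ring_map)
    show ?thesis by (simp add: Q_def E.diff E.mult)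
  qed
  \<comment> \<open>Indices up to \<open>n\<close> carry the solution of \<open>P\<close>, whose
    unknowns all lie there; index \<open>n + i\<close> carries the inverse that solves
    \<open>Q i\<close>.\<close>
  define z' where "z' i = (if i \<le> n then z i else inverse (z (i - n)))" for i
  have "difference_field_ext ring_of_type_algebra \<sigma> ring_of_type_algebra \<tau> amb_const"
    unfolding difference_field_ext_def difference_field_type_algebra
    using \<sigma> \<tau> by (auto simp: ring_hom_def ring_of_type_algebra_def amb_const.add amb_const.mult)
  moreover have "diff_solution ring_of_type_algebra \<tau> amb_const S z'"
    unfolding diff_solution_def diff_eval_eq_mp_eval
  proof (intro conjI allI ballI)
    fix p assume "p \<in> S"
    then consider "p = P" | i where "i \<in> {1..n}" "p = Q i" by (auto simp: S_def)
    then have "mp_eval amb_const (\<lambda>v. (\<tau> ^^ snd v) (z' (fst v))) p = 0"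
    proof cases
      case 1
      have "mp_eval amb_const (\<lambda>v. (\<tau> ^^ snd v) (z' (fst v))) P = mp_eval amb_const (\<lambda>v. (\<tau> ^^ snd v) (z (fst v))) P"
        using P(2) vars by (intro mp_eval_cong) (fastforce simp: z'_def mp_vars_def)
      then show ?thesis using z 1 by simp
    next
      case 2
      then show ?thesis using z(1) by (simp add: Q amb_const.ring_map_axioms z'_def)
    qed
    then show "mp_eval amb_const (\<lambda>v. (\<tau> ^^ snd v) (z' (fst v))) p = \<zero>\<^bsub>ring_of_type_algebra\<^esub>"
      by (simp add: type_algebra_simps(2))
  qed (simp add: ring_of_type_algebra_def)
  \<comment> \<open>The extension lives on the type of the ambient field rather than on words, which
    is why \<open>acfaD\<close> is used and not the definition of \<open>acfa\<close>.\<close>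
  ultimately obtain y where "diff_solution ring_of_type_algebra \<sigma> id S y"
    using acfaD[OF assms(1) \<open>finite S\<close>] by blast
  then have y: "mp_eval (\<lambda>c. c) (\<lambda>v. (\<sigma> ^^ snd v) (y (fst v))) p = 0" if "p \<in> S" for p
    using that by (auto simp: diff_solution_def diff_eval_eq_mp_eval id_def type_algebra_simps(2))
  have y_nz: "y i \<noteq> 0" if "i \<in> {1..n}" for i
    using y[of "Q i"] that by (auto simp: S_def Q ring_map_id)
  \<comment> \<open>Clearing denominators requires every substituted value to be nonzero, so all
    conjugates of the coordinates are considered.\<close>
  have "(\<sigma> ^^ j) (y i) \<noteq> 0" if "i \<in> {1..n}" for i j
  proof (induction j)
    case (Suc j)
    then show ?case using \<sigma> by (metis bij_is_inj comp_apply funpow.simps(2) injD ring_map.zero)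
  qed (use y_nz[OF that] in simp)
  then have "laurent_eval \<sigma> f y = 0"
    unfolding laurent_eval_def using vars y[of P] by (intro clear[rule_format]) (auto simp: S_def)
  then show ?thesis using y_nz by blast
qed

end
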